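(* Let $\mathbf M=(M,N)$ be a flag matroid of rank $(1,n-1)$ on $[n]$ such that the translated polytope $P_{\mathbf M}-(1,\dots,1)$ contains the origin. Then $P_{\mathbf M}$ is a Bruhat polytope if and only if the symbol sequence $\alpha(\mathbf M)$ has no isolated $*$.
   Context: $M$ has rank 1, $N$ rank $n-1$, every flat of $M$ is a flat of $N$; $P_{\mathbf M}=\operatorname{conv}\{e_i:\{i\}\text{ basis of }M\}+\operatorname{conv}\{e_B:B\text{ basis of }N\}$ with $e_B=\sum_{i\in B}e_i$. The symbol sequence $\alpha(\mathbf M)=(\alpha_1,\dots,\alpha_n)\in\{0,+,-,*\}^n$ has $\alpha_i=*$ if $\{i\}$ is a basis of $M$ and $[n]\setminus\{i\}$ is a basis of $N$; $\alpha_i=-$ if $\{i\}$ is a basis of $M$ but $[n]\setminus\{i\}$ is not a basis of $N$; $\alpha_i=+$ if $[n]\setminus\{i\}$ is a basis of $N$ but $\{i\}$ is not a basis of $M$; $\alpha_i=0$ otherwise. It has an isolated $*$ if some $\alpha_i=*$ while neither $\alpha_{i-1}$ nor $\alpha_{i+1}$ is $*$ (with $\alpha_0,\alpha_{n+1}$ regarded as not $*$). Bruhat polytopes of rank $(1,n-1)$: for $x\in\operatorname{Sym}_n$ let $\pi(x)\in\mathbb{R}^n$ have $k$-th coordinate $0$ if $x(k)=1$, $2$ if $x(k)=n$, and $1$ otherwise. A permutation $v$ is minimal if it is minimal in Bruhat order among all $x$ with $\pi(x)=\pi(v)$. For $u\le v$ in Bruhat order with $v$ minimal, the Bruhat polytope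 is $Q_{u,v}=\operatorname{conv}\{\pi(x):u\le x\le v\}$. ("Bruhat order": $u\le v$ iff a reduced word for $v$ in adjacent transpositions has a subword that is a word for $u$.) *)

theory Defs
  imports Complex_Main "HOL-Library.Sublist" "HOL-Combinatorics.Permutations"
begin

(* Points of R^n are represented as functions nat => real; only coordinates 1..n matter
   (all sets below consist of functions vanishing outside {1..n}). *)

definition conv_hull :: "(nat \<Rightarrow> real) set \<Rightarrow> (nat \<Rightarrow> real) set" where
  "conv_hull S = {y. \<exists>(k::nat) (c::nat \<Rightarrow> real) p.
      (\<forall>i<k. 0 \<le> c i \<and> p i \<in> S) \<and> (\<Sum>i<k. c i) = 1 \<and> y = (\<lambda>j. \<Sum>i<k. c i * p i j)}"

definition minkowski_sum :: "(nat \<Rightarrow> real) set \<Rightarrow> (nat \<Rightarrow> real) set \<Rightarrow> (nat \<Rightarrow> real) set" where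
  "minkowski_sum A B = {(\<lambda>j. a j + b j) | a b. a \<in> A \<and> b \<in> B}"

definition indic_vec :: "nat set \<Rightarrow> nat \<Rightarrow> real" where
  "indic_vec B = (\<lambda>j. if j \<in> B then 1 else 0)"

definition is_matroid :: "nat \<Rightarrow> nat set set \<Rightarrow> bool" where
  "is_matroid n \<B> \<longleftrightarrow> \<B> \<noteq> {} \<and> (\<forall>B\<in>\<B>. B \<subseteq> {1..n}) \<and>
     (\<forall>B1\<in>\<B>. \<forall>B2\<in>\<B>. \<forall>x\<in>B1 - B2. \<exists>y\<in>B2 - B1. insert y (B1 - {x}) \<in> \<B>)"

definition matroid_rank_of :: "nat set set \<Rightarrow> nat set \<Rightarrow> nat" where
  "matroid_rank_of \<B> A = Max ((\<lambda>B. card (A \<inter> B)) ` \<B>)"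

definition has_rank :: "nat \<Rightarrow> nat set set \<Rightarrow> nat \<Rightarrow> bool" where
  "has_rank n \<B> r \<longleftrightarrow> is_matroid n \<B> \<and> (\<forall>B\<in>\<B>. card B = r)"

definition is_flat :: "nat \<Rightarrow> nat set set \<Rightarrow> nat set \<Rightarrow> bool" where
  "is_flat n \<B> F \<longleftrightarrow> F \<subseteq> {1..n} \<and>
     (\<forall>e\<in>{1..n} - F. matroid_rank_of \<B> (insert e F) > matroid_rank_of \<B> F)"

definition flag_matroid_1_nm1 :: "nat \<Rightarrow> nat set set \<Rightarrow> nat set set \<Rightarrow> bool" where
  "flag_matroid_1_nm1 n M N \<longleftrightarrow> has_rank n M 1 \<and> has_rank n N (n - 1) \<and>
     (\<forall>F. is_flat n M F \<longrightarrow> is_flat n N F)"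

definition flag_polytope :: "nat \<Rightarrow> nat set set \<Rightarrow> nat set set \<Rightarrow> (nat \<Rightarrow> real) set" where
  "flag_polytope n M N = minkowski_sum
      (conv_hull {indic_vec {i} | i. i \<in> {1..n} \<and> {i} \<in> M})
      (conv_hull {indic_vec B | B. B \<in> N})"

datatype symbol = SZero | SPlus | SMinus | SStar

definition alpha :: "nat \<Rightarrow> nat set set \<Rightarrow> nat set set \<Rightarrow> nat \<Rightarrow> symbol" where
  "alpha n M N i =
     (if {i} \<in> M \<and> {1..n} - {i} \<in> N then SStar
      else if {i} \<in> M then SMinus
      else if {1..n} - {i} \<in> N then SPlus
      else SZero)"

definition has_isolated_star :: "nat \<Rightarrow> (nat \<Rightarrow> symbol) \<Rightarrow> bool" where
  "has_isolated_star n a \<longleftrightarrow> (\<exists>i\<in>{1..n}. a i = SStar \<and>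
      \<not> (i - 1 \<ge> 1 \<and> a (i - 1) = SStar) \<and> \<not> (i + 1 \<le> n \<and> a (i + 1) = SStar))"

definition Sym :: "nat \<Rightarrow> (nat \<Rightarrow> nat) set" where
  "Sym n = {x. x permutes {1..n}}"

definition word_perm :: "nat list \<Rightarrow> nat \<Rightarrow> nat" where
  "word_perm w = foldr (\<lambda>i f. transpose i (i + 1) \<circ> f) w id"

definition is_word :: "nat \<Rightarrow> nat list \<Rightarrow> (nat \<Rightarrow> nat) \<Rightarrow> bool" where
  "is_word n w x \<longleftrightarrow> set w \<subseteq> {1..<n} \<and> word_perm w = x"

definition is_reduced_word :: "nat \<Rightarrow> nat list \<Rightarrow> (nat \<Rightarrow> nat) \<Rightarrow> bool" where
  "is_reduced_word n w x \<longleftrightarrow> is_word n w x \<and> (\<forall>w'. is_word n w' x \<longrightarrow> length w \<le> length w')"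

definition bruhat_le :: "nat \<Rightarrow> (nat \<Rightarrow> nat) \<Rightarrow> (nat \<Rightarrow> nat) \<Rightarrow> bool" where
  "bruhat_le n u v \<longleftrightarrow> u \<in> Sym n \<and> v \<in> Sym n \<and>
     (\<exists>w w'. is_reduced_word n w v \<and> subseq w' w \<and> is_word n w' u)"

definition pi_vec :: "nat \<Rightarrow> (nat \<Rightarrow> nat) \<Rightarrow> nat \<Rightarrow> real" where
  "pi_vec n x = (\<lambda>k. if k \<in> {1..n} then (if x k = 1 then 0 else if x k = n then 2 else 1) else 0)"

definition minimal_perm :: "nat \<Rightarrow> (nat \<Rightarrow> nat) \<Rightarrow> bool" where
  "minimal_perm n v \<longleftrightarrow> v \<in> Sym n \<and>
     \<not> (\<exists>x\<in>Sym n. pi_vec n x = pi_vec n v \<and> bruhat_le n x v \<and> x \<noteq> v)"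

definition bruhat_polytope :: "nat \<Rightarrow> (nat \<Rightarrow> nat) \<Rightarrow> (nat \<Rightarrow> nat) \<Rightarrow> (nat \<Rightarrow> real) set" where
  "bruhat_polytope n u v = conv_hull {pi_vec n x | x. bruhat_le n u x \<and> bruhat_le n x v}"

definition is_bruhat_polytope :: "nat \<Rightarrow> (nat \<Rightarrow> real) set \<Rightarrow> bool" where
  "is_bruhat_polytope n P \<longleftrightarrow>
     (\<exists>u v. bruhat_le n u v \<and> minimal_perm n v \<and> P = bruhat_polytope n u v)"

end

theory Submission
  imports Defs
begin

text \<open>
  Let \<open>S = {i. {i} \<in> M}\<close> and \<open>T = {j. {1..n} - {j} \<in> N}\<close>; the stars are the elements of \<open>S \<inter> T\<close>. The flat condition
  rules out a single star and the origin condition rules out the absence of stars, so the polytope is the hull of the points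
  \<open>1 + e\<^sub>i - e\<^sub>j\<close> with \<open>i \<in> S\<close>, \<open>j \<in> T\<close>, \<open>i \<noteq> j\<close>, all of which are vertices. A Bruhat polytope is the hull of such
  points too, with \<open>i\<close> the position of \<open>n\<close> and \<open>j\<close> the position of \<open>1\<close>, so only sets of pairs have to be compared.

  Below a minimal \<open>v\<close> with \<open>n\<close> in position \<open>a\<close>, \<open>1\<close> in position \<open>b\<close> and \<open>a < b\<close>, every permutation crosses each
  gap \<open>p | p + 1\<close> at most once in each direction. For \<open>u \<le> v\<close> this determines which positions \<open>n\<close> and \<open>1\<close> take in
  the interval, and the positions available to both are exactly those adjacent to a gap between \<open>a\<close> and \<open>b\<close> that
  \<open>u\<close> does not cross. They come in adjacent pairs, so no star is isolated. Conversely, with \<open>a = Min S\<close> and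
  \<open>b = Max T\<close>, a suitable \<open>u\<close> realises any \<open>S\<close> and \<open>T\<close> without isolated star.
\<close>

section \<open>Bruhat order and rank functions\<close>

text \<open>
  The two counts differ by \<open>p - (q - 1)\<close>, so the Bruhat order can be tested on \<open>rk\<close> for \<open>p < q\<close> and on
  \<open>lk\<close> for \<open>q \<le> p\<close>. In these ranges both are at most 1 for the permutations below a minimal one.
\<close>

definition rk :: "(nat \<Rightarrow> nat) \<Rightarrow> nat \<Rightarrow> nat \<Rightarrow> nat" where
  "rk x p q = card {k \<in> {1..p}. q \<le> x k}"

definition lk :: "nat \<Rightarrow> (nat \<Rightarrow> nat) \<Rightarrow> nat \<Rightarrow> nat \<Rightarrow> nat" where
  "lk n x p q = card {k \<in> {p<..n}. x k < q}"

definition rank_le :: "nat \<Rightarrow> (nat \<Rightarrow> nat) \<Rightarrow> (nat \<Rightarrow> nat) \<Rightarrow> bool" where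
  "rank_le n x y \<longleftrightarrow> (\<forall>p q. p \<le> n \<longrightarrow> rk x p q \<le> rk y p q)"

section \<open>Inversions under left multiplication by an adjacent transposition\<close>

definition inversions :: "nat \<Rightarrow> (nat \<Rightarrow> nat) \<Rightarrow> (nat \<times> nat) set" where
  "inversions n x = {(k, l). k \<in> {1..n} \<and> l \<in> {1..n} \<and> k < l \<and> x l < x k}"

abbreviation adj :: "nat \<Rightarrow> nat \<Rightarrow> nat" where
  "adj i \<equiv> transpose i (Suc i)"

lemma finite_inversions [simp]: "finite (inversions n x)"
  by (rule finite_subset[of _ "{1..n} \<times> {1..n}"]) (auto simp: inversions_def)

lemma inversions_id [simp]: "inversions n id = {}"
  by (auto simp: inversions_def)

lemma permutes_position:
  fixes x :: "nat \<Rightarrow> nat"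
  assumes "x permutes {1..n}" "q \<in> {1..n}"
  obtains k where "k \<in> {1..n}" "x k = q"
  using assms by (metis permutes_image imageE)

lemma permutes_adjacent_positions:
  fixes x :: "nat \<Rightarrow> nat"
  assumes "x permutes {1..n}" "i \<in> {1..<n}"
  obtains c d where "c \<in> {1..n}" "d \<in> {1..n}" "x c = i" "x d = Suc i"
proof -
  have "i \<in> {1..n}" "Suc i \<in> {1..n}" using assms(2) by auto
  then show ?thesis using that permutes_position[OF assms(1)] by metis
qed

lemma adj_less_iff: "\<not> (m = i \<and> m' = Suc i) \<Longrightarrow> \<not> (m = Suc i \<and> m' = i) \<Longrightarrow> adj i m < adj i m' \<longleftrightarrow> m < m'"
  by (auto simp: transpose_def)

lemma adj_permutes: "i \<in> {1..<n} \<Longrightarrow> adj i permutes {1..n}"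
  by (rule permutes_swap_id) auto

lemma adj_comp_permutes: "x permutes {1..n} \<Longrightarrow> i \<in> {1..<n} \<Longrightarrow> (adj i \<circ> x) permutes {1..n}"
  by (rule permutes_compose[OF _ adj_permutes])

text \<open>The swap exchanges consecutive values, so the only comparison it changes is the one
  between \<open>i\<close> and \<open>Suc i\<close>, whose positions are \<open>c\<close> and
  \<open>d\<close>.\<close>

lemma inversions_adj_comp:
  assumes x: "x permutes {1..n}" and pos: "c \<in> {1..n}" "d \<in> {1..n}" "x c = i" "x d = Suc i" "c < d"
  shows "inversions n (adj i \<circ> x) = insert (c, d) (inversions n x)" "(c, d) \<notin> inversions n x"
proof -
  have inj: "inj x" using x by (rule permutes_inj)
  have C: "x k = i \<longleftrightarrow> k = c" "x k = Suc i \<longleftrightarrow> k = d" for k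
    using inj pos by (metis injD)+
  have "(k, l) \<in> inversions n (adj i \<circ> x) \<longleftrightarrow> (k, l) \<in> insert (c, d) (inversions n x)" for k l
  proof (cases "(k = c \<and> l = d) \<or> (k = d \<and> l = c)")
    case True
    then show ?thesis using pos by (auto simp: inversions_def transpose_def)
  next
    case False
    then have "adj i (x l) < adj i (x k) \<longleftrightarrow> x l < x k"
      by (intro adj_less_iff) (auto simp: C)
    then show ?thesis using False by (auto simp: inversions_def)
  qed
  then show "inversions n (adj i \<circ> x) = insert (c, d) (inversions n x)" by auto
  show "(c, d) \<notin> inversions n x" using pos by (auto simp: inversions_def)
qed

lemma card_inversions_adj_ascent:
  assumes "x permutes {1..n}" "c \<in> {1..n}" "d \<in> {1..n}" "x c = i" "x d = Suc i" "c < d"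
  shows "card (inversions n (adj i \<circ> x)) = Suc (card (inversions n x))"
  using inversions_adj_comp[OF assms] by simp

lemma card_inversions_adj_descent:
  assumes x: "x permutes {1..n}" and "c \<in> {1..n}" "d \<in> {1..n}" "x c = i" "x d = Suc i" "d < c" "i \<in> {1..<n}"
  shows "card (inversions n x) = Suc (card (inversions n (adj i \<circ> x)))"
proof -
  have "card (inversions n (adj i \<circ> (adj i \<circ> x))) = Suc (card (inversions n (adj i \<circ> x)))"
    using assms by (intro card_inversions_adj_ascent[where c = d and d = c] adj_comp_permutes) auto
  then show ?thesis by (simp add: comp_assoc[symmetric])
qed

section \<open>Words and reduced words; the length of a permutation as its number of
  inversions\<close>

lemma word_perm_Nil: "word_perm [] = id"
  by (rule ext) (simp add: word_perm_def)

lemma word_perm_Cons: "word_perm (i # w) = adj i \<circ> word_perm w"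
  by (simp add: word_perm_def)

lemma word_perm_permutes: "set w \<subseteq> {1..<n} \<Longrightarrow> word_perm w permutes {1..n}"
proof (induction w)
  case Nil
  show ?case unfolding word_perm_Nil by (rule permutes_id)
next
  case (Cons i w)
  then show ?case by (auto simp only: word_perm_Cons list.set intro!: adj_comp_permutes)
qed

text \<open>Each letter changes the number of inversions by exactly one. This is the lower bound on
  the length of a word; \<open>reduced_word_exists\<close> shows that it is attained.\<close>

lemma card_inversions_word_perm: "set w \<subseteq> {1..<n} \<Longrightarrow> card (inversions n (word_perm w)) \<le> length w"
proof (induction w)
  case Nil
  show ?case by (simp only: word_perm_Nil inversions_id card.empty list.size order_refl)
next
  case (Cons i w)
  let ?x = "word_perm w"
  have x: "?x permutes {1..n}" using Cons.prems by (intro word_perm_permutes) simp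
  have i: "i \<in> {1..<n}" using Cons.prems by simp
  obtain c d where cd: "c \<in> {1..n}" "d \<in> {1..n}" "?x c = i" "?x d = Suc i"
    using permutes_adjacent_positions[OF x i] by metis
  have "card (inversions n (adj i \<circ> ?x)) \<le> Suc (card (inversions n ?x))"
    using card_inversions_adj_ascent[OF x cd] card_inversions_adj_descent[OF x cd _ i] cd
    by (cases c d rule: linorder_cases) auto
  then show ?case using Cons by (simp flip: word_perm_Cons)
qed

lemma strict_mono_on_image_unique:
  fixes f g :: "nat \<Rightarrow> nat"
  assumes "strict_mono_on {a..<b} f" "strict_mono_on {a..<b} g" "f ` {a..<b} = g ` {a..<b}" "k \<in> {a..<b}"
  shows "f k = g k"
proof -
  have *: "sorted_wrt (<) (map h [a..<b])" if "strict_mono_on {a..<b} h" for h :: "nat \<Rightarrow> nat"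
    using that unfolding sorted_wrt_map
    by (intro sorted_wrt_mono_rel[OF _ sorted_wrt_upt]) (auto intro: strict_mono_onD)
  have "map f [a..<b] = map g [a..<b]"
    using assms(3) by (intro strict_sorted_equal *[OF assms(1)] *[OF assms(2)]) simp
  then show ?thesis using assms(4) by (auto simp: map_eq_conv)
qed

lemma strict_mono_on_if_step:
  fixes f :: "nat \<Rightarrow> nat"
  assumes "\<And>i. a \<le> i \<Longrightarrow> Suc i < b \<Longrightarrow> f i < f (Suc i)"
  shows "strict_mono_on {a..<b} f"
proof (rule strict_mono_onI)
  fix r s assume rs: "r \<in> {a..<b}" "s \<in> {a..<b}" "r < s"
  then have "Suc r \<le> s" by simp
  then show "f r < f s" using rs(1,2)
  proof (induction s rule: dec_induct)
    case base
    then show ?case using assms[of r] by simp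
  next
    case (step m)
    then show ?case using assms[of m] by fastforce
  qed
qed

text \<open>Both inverses map \<open>{a..<b}\<close> increasingly onto the same set, namely what the
  outer values leave over. The full range serves to recognise the identity, the range
  \<open>{2..<n}\<close> to recognise the minimal permutation.\<close>

lemma permutes_no_descent_eq:
  assumes x: "x permutes {1..n}" and y: "y permutes {1..n}"
    and outer: "\<And>q. q \<in> {1..n} - {a..<b} \<Longrightarrow> inv x q = inv y q"
    and "a \<ge> 1" "b \<le> n + 1"
    and nx: "\<And>i. a \<le> i \<Longrightarrow> Suc i < b \<Longrightarrow> inv x i < inv x (Suc i)"
    and ny: "\<And>i. a \<le> i \<Longrightarrow> Suc i < b \<Longrightarrow> inv y i < inv y (Suc i)"
  shows "x = y"
proof -
  note ix = permutes_inv[OF x] and iy = permutes_inv[OF y]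
  have sub: "{a..<b} = {1..n} - ({1..n} - {a..<b})" using assms by auto
  have "inv x ` {a..<b} = inv x ` {1..n} - inv x ` ({1..n} - {a..<b})"
    by (subst sub, subst image_set_diff[OF permutes_inj[OF ix]]) simp
  moreover have "inv y ` {a..<b} = inv y ` {1..n} - inv y ` ({1..n} - {a..<b})"
    by (subst sub, subst image_set_diff[OF permutes_inj[OF iy]]) simp
  moreover have "inv x ` ({1..n} - {a..<b}) = inv y ` ({1..n} - {a..<b})"
    using outer by (intro image_cong) auto
  ultimately have img: "inv x ` {a..<b} = inv y ` {a..<b}"
    using permutes_image[OF ix] permutes_image[OF iy] by simp
  have "inv x q = inv y q" for q
  proof (cases "q \<in> {1..n}")
    case False
    then show ?thesis using ix iy by (metis permutes_not_in)
  next
    case True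
    then show ?thesis
      using outer[of q] strict_mono_on_image_unique[OF strict_mono_on_if_step strict_mono_on_if_step img, of q] nx ny
      by blast
  qed
  then have "inv x = inv y" by auto
  then show ?thesis using x y by (metis permutes_inv_inv)
qed

lemma permutes_descent_exists:
  assumes x: "x permutes {1..n}" and "x \<noteq> id"
  obtains i c d where "i \<in> {1..<n}" "c \<in> {1..n}" "d \<in> {1..n}" "x c = i" "x d = Suc i" "d < c"
proof -
  have "\<exists>i. 1 \<le> i \<and> Suc i < n + 1 \<and> \<not> inv x i < inv x (Suc i)"
  proof (rule ccontr)
    assume "\<not> ?thesis"
    then have "x = id" using x by (intro permutes_no_descent_eq[of x n id 1 "n + 1"]) (auto simp: permutes_id)
    then show False using assms by simp
  qed
  then obtain i where i: "1 \<le> i" "i < n" "\<not> inv x i < inv x (Suc i)" by auto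
  have "inv x i \<noteq> inv x (Suc i)" using permutes_inj[OF permutes_inv[OF x]] by (metis injD n_not_Suc_n Suc_eq_plus1)
  moreover have "inv x i \<in> {1..n}" "inv x (Suc i) \<in> {1..n}"
    using i permutes_in_image[OF permutes_inv[OF x]] by auto
  ultimately show ?thesis
    using that[of i "inv x i" "inv x (Suc i)"] i permutes_inverses(1)[OF x] by auto
qed

text \<open>Sorting by swaps of consecutive values: every swap at a descent removes one inversion
  and contributes one letter.\<close>

lemma reduced_word_exists:
  assumes "x permutes {1..n}"
  shows "\<exists>w. is_word n w x \<and> length w = card (inversions n x)"
  using assms
proof (induction "card (inversions n x)" arbitrary: x rule: less_induct)
  case less
  show ?case
  proof (cases "x = id")
    case True
    then show ?thesis by (intro exI[of _ "[]"]) (simp add: is_word_def word_perm_Nil)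
  next
    case False
    then obtain i c d where i: "i \<in> {1..<n}" and cd: "c \<in> {1..n}" "d \<in> {1..n}" "x c = i" "x d = Suc i" "d < c"
      using permutes_descent_exists[OF less.prems] by metis
    have card: "card (inversions n x) = Suc (card (inversions n (adj i \<circ> x)))"
      using card_inversions_adj_descent[OF less.prems cd i] .
    obtain w where "is_word n w (adj i \<circ> x)" "length w = card (inversions n (adj i \<circ> x))"
      using less.hyps[of "adj i \<circ> x"] card adj_comp_permutes[OF less.prems i] by auto
    then show ?thesis using i card
      by (intro exI[of _ "i # w"]) (auto simp: is_word_def word_perm_Cons comp_assoc[symmetric])
  qed
qed

lemma is_reduced_word_iff:
  "is_reduced_word n w x \<longleftrightarrow> is_word n w x \<and> length w = card (inversions n x)"
proof -
  have "is_word n w' x \<Longrightarrow> card (inversions n x) \<le> length w'" for w'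
    using card_inversions_word_perm[of w' n] by (auto simp: is_word_def)
  moreover have "is_word n w x \<Longrightarrow> x permutes {1..n}"
    using word_perm_permutes[of w n] by (auto simp: is_word_def)
  ultimately show ?thesis
    unfolding is_reduced_word_def using reduced_word_exists[of x n] by (metis le_antisym)
qed

section \<open>The rank order and its lifting property\<close>

lemma rk_step:
  assumes "inj x" "x k = q" "1 \<le> k"
  shows "rk x p q = rk x p (Suc q) + of_bool (k \<le> p)"
proof -
  have "q \<le> x l \<longleftrightarrow> Suc q \<le> x l \<or> l = k" for l
    using assms(1,2) by (metis Suc_le_eq injD le_eq_less_or_eq)
  then have "{l \<in> {1..p}. q \<le> x l} = {l \<in> {1..p}. Suc q \<le> x l} \<union> (if k \<le> p then {k} else {})"
    using assms(3) by auto
  moreover have "k \<notin> {l \<in> {1..p}. Suc q \<le> x l}" using assms(2) by auto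
  ultimately show ?thesis by (auto simp: rk_def)
qed

lemma rk_adj_comp: "q \<noteq> Suc i \<Longrightarrow> rk (adj i \<circ> x) p q = rk x p q"
proof -
  assume "q \<noteq> Suc i"
  then have "q \<le> adj i m \<longleftrightarrow> q \<le> m" for m by (auto simp: transpose_def)
  then show ?thesis by (simp add: rk_def)
qed

lemma rk_adj_comp_eq:
  assumes "inj x" "x c = i" "1 \<le> c"
  shows "rk (adj i \<circ> x) p (Suc i) = rk x p (Suc (Suc i)) + of_bool (c \<le> p)"
proof -
  have "inj (adj i \<circ> x)" using assms(1) by (simp add: inj_compose)
  from rk_step[OF this, of c "Suc i" p] assms rk_adj_comp[of "Suc (Suc i)" i x p] show ?thesis
    by (simp add: add.assoc)
qed

lemma rank_le_refl [simp]: "rank_le n x x" by (simp add: rank_le_def)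

lemma rank_le_trans: "rank_le n x y \<Longrightarrow> rank_le n y z \<Longrightarrow> rank_le n x z"
  unfolding rank_le_def by (meson order_trans)

text \<open>The lifting property of the Bruhat order. Only the counts at the threshold
  \<open>Suc i\<close> change; there the inequality follows from those at \<open>i\<close>,
  \<open>Suc i\<close> and \<open>Suc (Suc i)\<close>, given that the swap raises \<open>v\<close>,
  or else that it lowers \<open>u\<close> (first claim) or would raise \<open>u\<close> (second
  claim).\<close>

lemma rank_le_adj:
  assumes u: "u permutes {1..n}" and v: "v permutes {1..n}"
    and pu: "a \<in> {1..n}" "b \<in> {1..n}" "u a = i" "u b = Suc i"
    and pv: "c \<in> {1..n}" "d \<in> {1..n}" "v c = i" "v d = Suc i"
    and le: "rank_le n u v"
  shows "c < d \<or> b < a \<Longrightarrow> rank_le n (adj i \<circ> u) (adj i \<circ> v)"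
    and "c < d \<or> a < b \<Longrightarrow> rank_le n u (adj i \<circ> v)"
proof -
  note iu = permutes_inj[OF u] and iv = permutes_inj[OF v]
  have ne: "c \<noteq> d" "a \<noteq> b" using pu pv by auto
  have facts: "rk u p i = rk u p (Suc i) + of_bool (a \<le> p)" "rk u p (Suc i) = rk u p (Suc (Suc i)) + of_bool (b \<le> p)"
    "rk v p i = rk v p (Suc i) + of_bool (c \<le> p)" "rk v p (Suc i) = rk v p (Suc (Suc i)) + of_bool (d \<le> p)"
    "rk (adj i \<circ> u) p (Suc i) = rk u p (Suc (Suc i)) + of_bool (a \<le> p)"
    "rk (adj i \<circ> v) p (Suc i) = rk v p (Suc (Suc i)) + of_bool (c \<le> p)" for p
    using rk_step[OF iu, of a i p] rk_step[OF iu, of b "Suc i" p] rk_step[OF iv, of c i p] rk_step[OF iv, of d "Suc i" p]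
      rk_adj_comp_eq[OF iu, of a i p] rk_adj_comp_eq[OF iv, of c i p] pu pv by (auto simp: add.assoc)
  have L: "rk u p q \<le> rk v p q" if "p \<le> n" for p q using le that by (simp add: rank_le_def)
  show "rank_le n (adj i \<circ> u) (adj i \<circ> v)" if "c < d \<or> b < a"
    unfolding rank_le_def
  proof (intro allI impI)
    fix p q assume p: "p \<le> n"
    show "rk (adj i \<circ> u) p q \<le> rk (adj i \<circ> v) p q"
    proof (cases "q = Suc i")
      case False
      then show ?thesis using L[OF p] by (simp add: rk_adj_comp)
    next
      case True
      have "rk u p (Suc (Suc i)) + of_bool (a \<le> p) \<le> rk v p (Suc (Suc i)) + of_bool (c \<le> p)"
        using L[OF p, of i] L[OF p, of "Suc i"] L[OF p, of "Suc (Suc i)"] that ne facts[of p]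
        by (auto simp: of_bool_def split: if_splits)
      then show ?thesis using facts[of p] True by simp
    qed
  qed
  show "rank_le n u (adj i \<circ> v)" if "c < d \<or> a < b"
    unfolding rank_le_def
  proof (intro allI impI)
    fix p q assume p: "p \<le> n"
    show "rk u p q \<le> rk (adj i \<circ> v) p q"
    proof (cases "q = Suc i")
      case False
      then show ?thesis using L[OF p] by (simp add: rk_adj_comp)
    next
      case True
      have "rk u p (Suc (Suc i)) + of_bool (b \<le> p) \<le> rk v p (Suc (Suc i)) + of_bool (c \<le> p)"
        using L[OF p, of i] L[OF p, of "Suc i"] L[OF p, of "Suc (Suc i)"] that ne facts[of p]
        by (auto simp: of_bool_def split: if_splits)
      then show ?thesis using facts[of p] True by simp
    qed
  qed
qed


lemma id_rank_le:
  assumes "x permutes {1..n}"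
  shows "rank_le n id x"
  using assms
proof (induction "card (inversions n x)" arbitrary: x rule: less_induct)
  case less
  show ?case
  proof (cases "x = id")
    case False
    then obtain i c d where i: "i \<in> {1..<n}" and cd: "c \<in> {1..n}" "d \<in> {1..n}" "x c = i" "x d = Suc i" "d < c"
      using permutes_descent_exists[OF less.prems] by metis
    let ?y = "adj i \<circ> x"
    have y: "?y permutes {1..n}" using adj_comp_permutes[OF less.prems i] .
    have "rank_le n id ?y"
      using less.hyps[of ?y] card_inversions_adj_descent[OF less.prems cd i] y by simp
    then have "rank_le n id (adj i \<circ> ?y)"
      using i cd by (intro rank_le_adj(2)[OF permutes_id y, of i "Suc i" i d c]) auto
    then show ?thesis by (simp add: comp_assoc[symmetric])
  qed simp
qed

text \<open>If the first letter removed an inversion, the remaining word would have more inversions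
  than letters. So it acts at an ascent, and the rest of the word is again reduced.\<close>

lemma reduced_Cons:
  assumes "set (i # w) \<subseteq> {1..<n}" "card (inversions n (word_perm (i # w))) = length (i # w)"
  obtains c d where "c \<in> {1..n}" "d \<in> {1..n}" "word_perm w c = i" "word_perm w d = Suc i" "c < d"
    "card (inversions n (word_perm w)) = length w"
proof -
  let ?x = "word_perm w"
  have x: "?x permutes {1..n}" using assms by (intro word_perm_permutes) simp
  have i: "i \<in> {1..<n}" using assms by simp
  obtain c d where cd: "c \<in> {1..n}" "d \<in> {1..n}" "?x c = i" "?x d = Suc i"
    using permutes_adjacent_positions[OF x i] by metis
  have le: "card (inversions n ?x) \<le> length w" using assms by (intro card_inversions_word_perm) auto
  have eq: "card (inversions n (adj i \<circ> ?x)) = Suc (length w)" using assms by (simp flip: word_perm_Cons)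
  have "c < d"
    using card_inversions_adj_descent[OF x cd _ i] le eq cd by (cases c d rule: linorder_cases) auto
  then show ?thesis using that[OF cd] card_inversions_adj_ascent[OF x cd] eq by simp
qed

text \<open>A letter kept in the subword is handled by the first claim of the lifting property, a
  dropped one by the second. Both apply because in a reduced word each letter acts at an
  ascent.\<close>

lemma rank_le_word_perm:
  assumes "subseq w' w" "set w \<subseteq> {1..<n}" "card (inversions n (word_perm w)) = length w"
  shows "set w' \<subseteq> {1..<n} \<and> rank_le n (word_perm w') (word_perm w)"
  using assms
proof (induction w' w rule: list_emb.induct)
  case (list_emb_Nil ys)
  then have "rank_le n id (word_perm ys)" by (intro id_rank_le word_perm_permutes)
  then show ?case by (simp only: word_perm_Nil list.set empty_subsetI simp_thms)
next
  case step: (list_emb_Cons xs ys i)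
  obtain c d where cd: "c \<in> {1..n}" "d \<in> {1..n}" "word_perm ys c = i" "word_perm ys d = Suc i" "c < d"
    and red: "card (inversions n (word_perm ys)) = length ys"
    using reduced_Cons[OF step.prems] by metis
  have IH: "set xs \<subseteq> {1..<n}" "rank_le n (word_perm xs) (word_perm ys)" using step red by auto
  have i: "i \<in> {1..<n}" and ys: "set ys \<subseteq> {1..<n}" using step.prems by auto
  note px = word_perm_permutes[OF IH(1)]
  obtain a b where "a \<in> {1..n}" "b \<in> {1..n}" "word_perm xs a = i" "word_perm xs b = Suc i"
    using permutes_adjacent_positions[OF px i] by metis
  from rank_le_adj(2)[OF px word_perm_permutes[OF ys] this cd(1-4) IH(2)] cd(5) IH(1)
  show ?case by (simp flip: word_perm_Cons)
next
  case step: (list_emb_Cons2 j i xs ys)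
  obtain c d where cd: "c \<in> {1..n}" "d \<in> {1..n}" "word_perm ys c = i" "word_perm ys d = Suc i" "c < d"
    and red: "card (inversions n (word_perm ys)) = length ys"
    using reduced_Cons[OF step.prems] by metis
  have IH: "set xs \<subseteq> {1..<n}" "rank_le n (word_perm xs) (word_perm ys)" using step red by auto
  have i: "i \<in> {1..<n}" and ys: "set ys \<subseteq> {1..<n}" using step.prems by auto
  note px = word_perm_permutes[OF IH(1)]
  obtain a b where "a \<in> {1..n}" "b \<in> {1..n}" "word_perm xs a = i" "word_perm xs b = Suc i"
    using permutes_adjacent_positions[OF px i] by metis
  from rank_le_adj(1)[OF px word_perm_permutes[OF ys] this cd(1-4) IH(2)] cd(5) IH(1) i step.hyps
  show ?case by (simp flip: word_perm_Cons)
qed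

text \<open>A permutation can be recovered from its counts: by \<open>rk_step\<close>, the
  thresholds \<open>q\<close> and \<open>Suc q\<close> tell whether the value \<open>q\<close>
  stands at or before \<open>p\<close>.\<close>

lemma rank_le_antisym:
  assumes x: "x permutes {1..n}" and y: "y permutes {1..n}" and "rank_le n x y" "rank_le n y x"
  shows "x = y"
proof
  fix k
  show "x k = y k"
  proof (cases "k \<in> {1..n}")
    case False
    then show ?thesis using x y by (metis permutes_not_in)
  next
    case True
    then have q: "x k \<in> {1..n}" using permutes_in_image[OF x] by blast
    then obtain l where l: "l \<in> {1..n}" "y l = x k" using permutes_position[OF y] by metis
    have eq: "rk x p q = rk y p q" if "p \<le> n" for p q
      using assms(3,4) that by (auto simp: rank_le_def intro!: le_antisym)
    have "k \<le> p \<longleftrightarrow> l \<le> p" if "p \<le> n" for p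
    proof -
      have "rk x p (x k) = rk x p (Suc (x k)) + of_bool (k \<le> p)"
        using rk_step[OF permutes_inj[OF x] refl] True by simp
      moreover have "rk y p (x k) = rk y p (Suc (x k)) + of_bool (l \<le> p)"
        using rk_step[OF permutes_inj[OF y] l(2)] l(1) by simp
      ultimately have "of_bool (k \<le> p) = (of_bool (l \<le> p) :: nat)"
        using eq[OF that, of "x k"] eq[OF that, of "Suc (x k)"] by linarith
      then show ?thesis by (simp only: of_bool_eq_iff)
    qed
    from this[of k] this[of l] True l(1) have "k = l" by auto
    then show ?thesis using l by simp
  qed
qed

text \<open>A descent \<open>i\<close> of \<open>v\<close> becomes the first letter of its reduced
  word. By lifting, the lowered \<open>v\<close> lies above \<open>u\<close> itself if
  \<open>i\<close> is an ascent of \<open>u\<close>, and the letter is dropped; otherwise it lies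
  above the lowered \<open>u\<close>, and the letter is kept.\<close>

lemma rank_le_subword:
  assumes "u permutes {1..n}" "v permutes {1..n}" "rank_le n u v"
  shows "\<exists>w w'. is_word n w v \<and> length w = card (inversions n v) \<and> subseq w' w \<and> is_word n w' u"
  using assms
proof (induction "card (inversions n v)" arbitrary: u v rule: less_induct)
  case less
  note u = less.prems(1) and v = less.prems(2)
  show ?case
  proof (cases "v = id")
    case True
    then have "u = id" using less.prems id_rank_le[OF u] rank_le_antisym[OF u permutes_id] by blast
    then show ?thesis using True
      by (intro exI[of _ "[]"]) (simp add: is_word_def word_perm_Nil)
  next
    case False
    then obtain i c d where i: "i \<in> {1..<n}" and cd: "c \<in> {1..n}" "d \<in> {1..n}" "v c = i" "v d = Suc i" "d < c"
      using permutes_descent_exists[OF v] by metis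
    obtain a b where ab: "a \<in> {1..n}" "b \<in> {1..n}" "u a = i" "u b = Suc i"
      using permutes_adjacent_positions[OF u i] by metis
    note card = card_inversions_adj_descent[OF v cd i]
    note v' = adj_comp_permutes[OF v i]
    consider "a < b" | "b < a" using ab by (cases a b rule: linorder_cases) auto
    then show ?thesis
    proof cases
      case 1
      obtain w w' where w: "is_word n w (adj i \<circ> v)" "length w = card (inversions n (adj i \<circ> v))"
        "subseq w' w" "is_word n w' u"
        using less.hyps[OF _ u v' rank_le_adj(2)[OF u v ab cd(1-4) less.prems(3)]] 1 card by auto
      then show ?thesis using i card
        by (intro exI[of _ "i # w"] exI[of _ w']) (auto simp: is_word_def word_perm_Cons comp_assoc[symmetric])
    next
      case 2
      obtain w w' where w: "is_word n w (adj i \<circ> v)" "length w = card (inversions n (adj i \<circ> v))"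
        "subseq w' w" "is_word n w' (adj i \<circ> u)"
        using less.hyps[OF _ adj_comp_permutes[OF u i] v' rank_le_adj(1)[OF u v ab cd(1-4) less.prems(3)]] 2 card by auto
      then show ?thesis using i card
        by (intro exI[of _ "i # w"] exI[of _ "i # w'"]) (auto simp: is_word_def word_perm_Cons comp_assoc[symmetric])
    qed
  qed
qed

theorem bruhat_le_iff_rank_le:
  "bruhat_le n u v \<longleftrightarrow> u permutes {1..n} \<and> v permutes {1..n} \<and> rank_le n u v"
proof
  assume "bruhat_le n u v"
  then show "u permutes {1..n} \<and> v permutes {1..n} \<and> rank_le n u v"
    using rank_le_word_perm by (fastforce simp: bruhat_le_def Sym_def is_reduced_word_iff is_word_def)
next
  assume "u permutes {1..n} \<and> v permutes {1..n} \<and> rank_le n u v"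
  then show "bruhat_le n u v"
    using rank_le_subword[of u n v] by (auto simp: bruhat_le_def Sym_def is_reduced_word_iff)
qed

section \<open>Permutations with at most one crossing\<close>

text \<open>Double counting around the positions up to \<open>p\<close> with value below
  \<open>q\<close>: together with those of \<open>rk\<close> they make up \<open>p\<close>
  positions, together with those of \<open>lk\<close> they hold the \<open>q - 1\<close> smallest
  values.\<close>

lemma rk_lk:
  assumes x: "x permutes {1..n}" and "p \<le> n" "1 \<le> q" "q \<le> n"
  shows "rk x p q + (q - 1) = p + lk n x p q"
proof -
  let ?L = "{k \<in> {1..p}. x k < q}"
  have "{k \<in> {1..n}. x k \<in> {1..<q}} = ?L \<union> {k \<in> {p<..n}. x k < q}"
  proof -
    have "1 \<le> x k" if "1 \<le> k" "k \<le> n" for k using permutes_in_image[OF x, of k] that by simp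
    then show ?thesis using assms(2,4) by auto
  qed
  moreover have "card {k \<in> {1..n}. x k \<in> {1..<q}} = card {1..<q}"
  proof (rule bij_betw_same_card[of x])
    show "bij_betw x {k \<in> {1..n}. x k \<in> {1..<q}} {1..<q}"
      unfolding bij_betw_def
    proof
      show "inj_on x {k \<in> {1..n}. x k \<in> {1..<q}}" using permutes_inj[OF x] by (rule inj_on_subset) simp
      have "m \<in> x ` {k \<in> {1..n}. x k \<in> {1..<q}}" if "m \<in> {1..<q}" for m
      proof -
        have "m \<in> {1..n}" using that assms by auto
        then obtain k where "k \<in> {1..n}" "x k = m" using permutes_position[OF x] by metis
        then show ?thesis using that by blast
      qed
      then show "x ` {k \<in> {1..n}. x k \<in> {1..<q}} = {1..<q}" by blast
    qed
  qed
  moreover have "card (?L \<union> {k \<in> {p<..n}. x k < q}) = card ?L + lk n x p q"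
    unfolding lk_def by (rule card_Un_disjoint) auto
  moreover have "card (?L \<union> {k \<in> {1..p}. q \<le> x k}) = card ?L + rk x p q"
    unfolding rk_def by (rule card_Un_disjoint) auto
  moreover have "?L \<union> {k \<in> {1..p}. q \<le> x k} = {1..p}" by auto
  ultimately show ?thesis by simp
qed

lemma rk_mono: "p \<le> p' \<Longrightarrow> q' \<le> q \<Longrightarrow> rk x p q \<le> rk x p' q'"
  unfolding rk_def by (rule card_mono) auto

lemma lk_mono: "p' \<le> p \<Longrightarrow> q \<le> q' \<Longrightarrow> lk n x p q \<le> lk n x p' q'"
  unfolding lk_def by (rule card_mono) auto

lemma rk_eq_0_iff: "rk x p q = 0 \<longleftrightarrow> (\<forall>k. 1 \<le> k \<longrightarrow> k \<le> p \<longrightarrow> x k < q)"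
proof -
  have "rk x p q = 0 \<longleftrightarrow> {k \<in> {1..p}. q \<le> x k} = {}" unfolding rk_def by (rule card_0_eq) simp
  also have "\<dots> \<longleftrightarrow> (\<forall>k. 1 \<le> k \<longrightarrow> k \<le> p \<longrightarrow> x k < q)" by (simp add: set_eq_iff) (meson not_le)
  finally show ?thesis .
qed

lemma lk_eq_0_iff: "lk n x p q = 0 \<longleftrightarrow> (\<forall>k. p < k \<longrightarrow> k \<le> n \<longrightarrow> q \<le> x k)"
proof -
  have "lk n x p q = 0 \<longleftrightarrow> {k \<in> {p<..n}. x k < q} = {}" unfolding lk_def by (rule card_0_eq) simp
  also have "\<dots> \<longleftrightarrow> (\<forall>k. p < k \<longrightarrow> k \<le> n \<longrightarrow> q \<le> x k)" by (simp add: set_eq_iff) (meson not_less)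
  finally show ?thesis .
qed

lemma rk_Suc_eq_lk:
  assumes "x permutes {1..n}" "p < n"
  shows "rk x p (Suc p) = lk n x p (Suc p)"
  using rk_lk[of x n p "Suc p"] assms by simp

lemma rank_leD_lk:
  assumes "rank_le n x y" "x permutes {1..n}" "y permutes {1..n}" "p \<le> n" "1 \<le> q" "q \<le> n"
  shows "lk n x p q \<le> lk n y p q"
proof -
  have "rk x p q \<le> rk y p q" using assms by (simp add: rank_le_def)
  then show ?thesis using rk_lk[of x n p q] rk_lk[of y n p q] assms by simp
qed

lemma rank_leI:
  assumes x: "x permutes {1..n}" and y: "y permutes {1..n}"
    and r: "\<And>p q. 1 \<le> p \<Longrightarrow> p < q \<Longrightarrow> q \<le> n \<Longrightarrow> rk x p q \<le> rk y p q"
    and l: "\<And>p q. 1 \<le> q \<Longrightarrow> q \<le> p \<Longrightarrow> p < n \<Longrightarrow> lk n x p q \<le> lk n y p q"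
  shows "rank_le n x y"
  unfolding rank_le_def
proof (intro allI impI)
  fix p q assume p: "p \<le> n"
  consider "q = 0" | "p = 0" | "q > n" | "1 \<le> p" "p < q" "q \<le> n" | "1 \<le> q" "q \<le> p" "p < n" | "1 \<le> q" "q \<le> p" "p = n"
    using p by linarith
  then show "rk x p q \<le> rk y p q"
  proof cases
    case 3
    have "rk x p q = 0" unfolding rk_eq_0_iff
      using 3 p permutes_in_image[OF x] by (meson atLeastAtMost_iff le_trans leI not_less)
    then show ?thesis by simp
  next
    case 5
    then show ?thesis using rk_lk[OF x p] rk_lk[OF y p] l[of q p] by fastforce
  next
    case 6
    have "lk n x p q = 0" by (simp add: lk_eq_0_iff 6)
    then show ?thesis using 6 rk_lk[OF x p, of q] rk_lk[OF y p, of q] by simp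
  next
    case 4
    then show ?thesis by (rule r)
  qed (simp_all add: rk_def)
qed

text \<open>
  \<open>C\<close> is the set of gaps \<open>p | p + 1\<close> that the permutation crosses. Each maximal run of crossed gaps is cut at the
  points of \<open>A\<close> into upward arcs and at the points of \<open>D\<close> into downward arcs; the permutation moves one end of
  every arc to the other. It is well defined because an interior point of a run is not cut in both ways.
  Growing in Bruhat order means more crossed gaps and fewer cuts.
\<close>

definition arc_perm :: "nat set \<Rightarrow> nat set \<Rightarrow> nat set \<Rightarrow> nat \<Rightarrow> nat" where
  "arc_perm C A D k =
     (if k \<in> C \<and> k \<in> A then LEAST m. k < m \<and> m \<in> A
      else if k - 1 \<in> C \<and> k \<in> D then Max {m \<in> D. m < k}
      else k)"

text \<open>\<open>AD\<close> combines two demands: a point with an uncrossed gap on some side is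
  cut in both ways, which keeps arcs inside their run, and any other point is cut in at most one
  way. As \<open>0\<close> and \<open>n\<close> are not in \<open>C\<close>, the points
  \<open>1\<close> and \<open>n\<close> are cuts when \<open>n \<ge> 1\<close>.\<close>

locale arcs =
  fixes n :: nat and C A D :: "nat set"
  assumes C: "C \<subseteq> {1..<n}" and A: "A \<subseteq> {1..n}" and D: "D \<subseteq> {1..n}"
    and AD: "A \<inter> D = {m \<in> {1..n}. m \<notin> C \<or> m - 1 \<notin> C}"
begin

lemma in_AD: "m \<in> {1..n} \<Longrightarrow> m \<notin> C \<or> m - 1 \<notin> C \<Longrightarrow> m \<in> A \<and> m \<in> D"
  using AD by blast

lemma not_AD: "m \<in> A \<Longrightarrow> m \<in> D \<Longrightarrow> m \<notin> C \<or> m - 1 \<notin> C"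
  using AD by blast

lemma arc_up:
  assumes k: "k \<in> C" "k \<in> A"
  shows "k < arc_perm C A D k" "arc_perm C A D k \<in> A" "\<And>m. k < m \<Longrightarrow> m < arc_perm C A D k \<Longrightarrow> m \<notin> A"
    "arc_perm C A D k - 1 \<in> C"
proof -
  let ?t = "LEAST m. k < m \<and> m \<in> A"
  have t: "arc_perm C A D k = ?t" using k by (simp add: arc_perm_def)
  have "k < n \<and> n \<in> A" using k C in_AD[of n] by fastforce
  from LeastI[of "\<lambda>m. k < m \<and> m \<in> A", OF this] have L: "k < ?t \<and> ?t \<in> A" .
  have N: "m \<notin> A" if "k < m" "m < ?t" for m using not_less_Least[OF that(2)] that(1) by blast
  show "k < arc_perm C A D k" "arc_perm C A D k \<in> A" using L t by simp_all
  show "m \<notin> A" if "k < m" "m < arc_perm C A D k" for m using N[of m] that t by simp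
  \<comment> \<open>If the gap just before the target were uncrossed, the point preceding the target
    would be a cut inside the arc.\<close>
  show "arc_perm C A D k - 1 \<in> C"
  proof (cases "?t = Suc k")
    case True
    then show ?thesis using t k by simp
  next
    case False
    then have "?t - 1 \<notin> A" using N[of "?t - 1"] L by linarith
    moreover have "?t - 1 \<in> {1..n}" using L A False by fastforce
    ultimately show ?thesis using in_AD[of "?t - 1"] t by metis
  qed
qed

lemma arc_down:
  assumes k: "k - 1 \<in> C" "k \<in> D"
  shows "arc_perm C A D k < k" "arc_perm C A D k \<in> D" "\<And>m. m < k \<Longrightarrow> arc_perm C A D k < m \<Longrightarrow> m \<notin> D"
    "arc_perm C A D k \<in> C"
proof -
  let ?X = "{m \<in> D. m < k}"
  \<comment> \<open>A point between two crossed gaps is not cut in both ways, so the first branch of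
    \<open>arc_perm\<close> does not apply to \<open>k\<close>.\<close>
  have "\<not> (k \<in> C \<and> k \<in> A)" using k not_AD[of k] by blast
  then have t: "arc_perm C A D k = Max ?X" unfolding arc_perm_def using k by presburger
  have k1: "1 \<le> k - 1" using k C by fastforce
  have fin: "finite ?X" by simp
  have "1 \<notin> C \<or> 1 - 1 \<notin> C" using C by auto
  then have "1 \<in> ?X" using in_AD[of 1] k D k1 by fastforce
  then have L: "Max ?X \<in> ?X" using Max_in[OF fin] by blast
  have N: "m \<notin> D" if "m < k" "Max ?X < m" for m
    using Max_ge[OF fin, of m] that by (metis (mono_tags, lifting) leD mem_Collect_eq)
  show "arc_perm C A D k < k" "arc_perm C A D k \<in> D" using L t by simp_all
  show "m \<notin> D" if "m < k" "arc_perm C A D k < m" for m using N[of m] that t by simp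
  show "arc_perm C A D k \<in> C"
  proof (cases "Suc (Max ?X) = k")
    case True
    then show ?thesis using t k by (metis diff_Suc_1)
  next
    case False
    then have "Suc (Max ?X) \<notin> D" using N[of "Suc (Max ?X)"] L by auto
    moreover have "Suc (Max ?X) \<in> {1..n}" using False L k D by fastforce
    ultimately show ?thesis using in_AD[of "Suc (Max ?X)"] t by auto
  qed
qed

lemma arc_fixed: "\<not> (k \<in> C \<and> k \<in> A) \<Longrightarrow> \<not> (k - 1 \<in> C \<and> k \<in> D) \<Longrightarrow> arc_perm C A D k = k"
  by (simp only: arc_perm_def if_False)

lemma arc_cases:
  obtains (up) "k \<in> C" "k \<in> A" "k < arc_perm C A D k"
  | (down) "k - 1 \<in> C" "k \<in> D" "arc_perm C A D k < k"
  | (fixed) "k \<in> C \<longrightarrow> k \<notin> A" "k - 1 \<in> C \<longrightarrow> k \<notin> D" "arc_perm C A D k = k"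
proof (cases "k \<in> C \<and> k \<in> A")
  case True
  then show ?thesis using that(1) arc_up(1) by blast
next
  case nup: False
  show ?thesis
  proof (cases "k - 1 \<in> C \<and> k \<in> D")
    case True
    then show ?thesis using that(2) arc_down(1) by blast
  next
    case False
    have "arc_perm C A D k = k" using arc_fixed[OF nup False] .
    then show ?thesis using that(3) nup False by blast
  qed
qed

text \<open>Injectivity is the point: the target of an upward arc lies in \<open>A\<close> with a
  crossed gap on its left, that of a downward arc lies in \<open>D\<close> with a crossed gap on its
  right. By \<open>AD\<close> no point is both, and neither kind of target is a fixed point.\<close>

lemma permutes: "arc_perm C A D permutes {1..n}"
proof (rule bij_imp_permutes)
  show "arc_perm C A D k = k" if "k \<notin> {1..n}" for k
    using that A D by (intro arc_fixed) auto
  have inj: "inj_on (arc_perm C A D) {1..n}"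
  proof (rule inj_onI)
    have main: False if eq: "arc_perm C A D k = arc_perm C A D l" and kl: "k \<in> {1..n}" "l \<in> {1..n}" and lt: "k < l" for k l
    proof (cases k rule: arc_cases)
      case k: up
      show ?thesis
      proof (cases l rule: arc_cases)
        case up
        then show ?thesis using arc_up(3)[OF k(1,2), of l] lt eq by simp
      next
        case down
        then show ?thesis using arc_up[OF k(1,2)] arc_down[OF down(1,2)] eq not_AD by metis
      next
        case fixed
        then show ?thesis using arc_up[OF k(1,2)] eq in_AD[OF kl(2)] by metis
      qed
    next
      case k: down
      show ?thesis
      proof (cases l rule: arc_cases)
        case up
        then show ?thesis using k eq lt by simp
      next
        case down
        then show ?thesis using arc_down(3)[OF down(1,2), of k] k lt eq by simp
      next
        case fixed
        then show ?thesis using k eq lt by simp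
      qed
    next
      case k: fixed
      show ?thesis
      proof (cases l rule: arc_cases)
        case up
        then show ?thesis using k eq lt by simp
      next
        case down
        then show ?thesis using arc_down[OF down(1,2)] k eq in_AD[OF kl(1)] by metis
      next
        case fixed
        then show ?thesis using k eq lt by simp
      qed
    qed
    fix k l assume *: "k \<in> {1..n}" "l \<in> {1..n}" "arc_perm C A D k = arc_perm C A D l"
    show "k = l" using main[of k l] main[of l k] * by (cases k l rule: linorder_cases) auto
  qed
  have "arc_perm C A D k \<in> {1..n}" if "k \<in> {1..n}" for k
  proof (cases k rule: arc_cases)
    case up
    then show ?thesis using arc_up(2)[OF up(1,2)] A by blast
  next
    case down
    then show ?thesis using arc_down(2)[OF down(1,2)] D by blast
  qed (use that in simp)
  then have "arc_perm C A D ` {1..n} = {1..n}"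
    by (intro endo_inj_surj inj) auto
  with inj show "bij_betw (arc_perm C A D) {1..n} {1..n}" by (simp add: bij_betw_def)
qed

text \<open>The counted positions are the starts of upward arcs that pass over the gap
  \<open>p\<close> and reach \<open>q\<close> or beyond. There is at most one, since the later of
  two starts would be a cut inside the arc of the earlier.\<close>

lemma rk_eq:
  assumes pq: "1 \<le> p" "p < q" "q \<le> n"
  shows "rk (arc_perm C A D) p q = of_bool (p \<in> C \<and> A \<inter> {p<..<q} = {})"
proof -
  let ?x = "arc_perm C A D"
  let ?K = "{k \<in> {1..p}. q \<le> ?x k}"
  have K: "k \<in> C \<and> k \<in> A" if "k \<in> ?K" for k
  proof (cases k rule: arc_cases)
  qed (use that pq in simp_all)
  have uniq: "k = l" if "k \<in> ?K" "l \<in> ?K" for k l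
  proof -
    have lt: False if kl: "k \<in> ?K" "l \<in> ?K" "k < l" for k l
    proof -
      have "l < ?x k" using kl pq by simp
      then show False using arc_up(3)[of k l] K[OF kl(1)] K[OF kl(2)] kl(3) by blast
    qed
    show ?thesis using lt[OF that] lt[OF that(2,1)] by (cases k l rule: linorder_cases) simp_all
  qed
  have ex: "?K \<noteq> {} \<longleftrightarrow> p \<in> C \<and> A \<inter> {p<..<q} = {}"
  proof
    assume "?K \<noteq> {}"
    then obtain k where k: "k \<in> ?K" by blast
    then have kk: "k \<le> p" "q \<le> ?x k" by auto
    note u = arc_up(3)[of k] and Kk = K[OF k]
    have "p \<in> C"
    proof (cases "k = p")
      case False
      then have "p \<notin> A" using u[of p] Kk kk pq by auto
      then show ?thesis using in_AD[of p] pq by auto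
    qed (use Kk in simp)
    moreover have "A \<inter> {p<..<q} = {}" using u Kk kk by auto
    ultimately show "p \<in> C \<and> A \<inter> {p<..<q} = {}" by simp
  next
    assume pC: "p \<in> C \<and> A \<inter> {p<..<q} = {}"
    \<comment> \<open>The arc over the gap \<open>p\<close> starts at the last upward cut not beyond
      \<open>p\<close>, which exists because \<open>1\<close> is a cut.\<close>
    let ?X = "{m \<in> A. m \<le> p}"
    have fin: "finite ?X" by simp
    have "0 \<notin> C" using C by auto
    then have "1 \<in> ?X" using in_AD[of 1] pq by auto
    then have L: "Max ?X \<in> ?X" using Max_in[OF fin] by blast
    define k where "k = Max ?X"
    have N: "m \<notin> A" if "k < m" "m \<le> p" for m
      using Max_ge[OF fin, of m] that unfolding k_def by (metis (mono_tags, lifting) leD mem_Collect_eq)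
    have k: "k \<in> A" "k \<le> p" using L by (auto simp: k_def)
    have "k \<in> C"
    proof (cases "k = p")
      case False
      then have "Suc k \<notin> A" using N k by auto
      then show ?thesis using in_AD[of "Suc k"] k pq False by auto
    qed (use pC in simp)
    have "q \<le> ?x k"
    proof (rule ccontr)
      assume "\<not> ?thesis"
      then have "?x k \<le> p \<or> ?x k \<in> {p<..<q}" by auto
      then show False using N[of "?x k"] arc_up(1,2)[OF \<open>k \<in> C\<close> k(1)] pC by auto
    qed
    then have "k \<in> ?K" using k A by auto
    then show "?K \<noteq> {}" by blast
  qed
  have "card ?K = of_bool (?K \<noteq> {})"
  proof (cases "?K = {}")
    case False
    then obtain k where k: "k \<in> ?K" by blast
    have "?K = {k}"
    proof
      show "?K \<subseteq> {k}" using uniq[OF _ k] by blast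
    qed (use k in blast)
    then have "card ?K = 1" by (metis is_singletonI is_singleton_altdef)
    then show ?thesis using False by (simp only: of_bool_eq(2) not_False_eq_True)
  qed (simp only: card.empty simp_thms of_bool_eq)
  then show ?thesis unfolding rk_def ex .
qed

text \<open>Mirror image of \<open>rk_eq\<close> for downward arcs. For \<open>q = Suc p\<close> the
  interval \<open>{q..p}\<close> is empty and only the crossing of the gap \<open>p\<close>
  matters.\<close>

lemma lk_eq:
  assumes pq: "1 \<le> q" "q \<le> Suc p" "p < n" "1 \<le> p"
  shows "lk n (arc_perm C A D) p q = of_bool (p \<in> C \<and> D \<inter> {q..p} = {})"
proof -
  let ?x = "arc_perm C A D"
  let ?K = "{k \<in> {p<..n}. ?x k < q}"
  have K: "k - 1 \<in> C \<and> k \<in> D" if "k \<in> ?K" for k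
  proof (cases k rule: arc_cases)
  qed (use that pq in simp_all)
  have uniq: "k = l" if "k \<in> ?K" "l \<in> ?K" for k l
  proof -
    have lt: False if kl: "k \<in> ?K" "l \<in> ?K" "k < l" for k l
    proof -
      have "?x l < k" using kl pq by simp
      then show False using arc_down(3)[of l k] K[OF kl(1)] K[OF kl(2)] kl(3) by blast
    qed
    show ?thesis using lt[OF that] lt[OF that(2,1)] by (cases k l rule: linorder_cases) simp_all
  qed
  have ex: "?K \<noteq> {} \<longleftrightarrow> p \<in> C \<and> D \<inter> {q..p} = {}"
  proof
    assume "?K \<noteq> {}"
    then obtain k where k: "k \<in> ?K" by blast
    then have kk: "p < k" "k \<le> n" "?x k < q" by auto
    note u = arc_down(3)[of k] and Kk = K[OF k]
    have "p \<in> C"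
    proof (cases "k = Suc p")
      case False
      then have "Suc p \<notin> D" using u[of "Suc p"] Kk kk pq by auto
      then show ?thesis using in_AD[of "Suc p"] pq by auto
    qed (use Kk in simp)
    moreover have "D \<inter> {q..p} = {}" using u Kk kk by auto
    ultimately show "p \<in> C \<and> D \<inter> {q..p} = {}" by simp
  next
    assume pC: "p \<in> C \<and> D \<inter> {q..p} = {}"
    define k where "k = (LEAST m. p < m \<and> m \<in> D)"
    have "n \<notin> C" using C by auto
    then have "p < n \<and> n \<in> D" using in_AD[of n] pq by auto
    from LeastI[of "\<lambda>m. p < m \<and> m \<in> D", OF this] have k: "p < k" "k \<in> D" by (auto simp: k_def)
    have N: "m \<notin> D" if "p < m" "m < k" for m
      using not_less_Least[of m "\<lambda>m. p < m \<and> m \<in> D"] that by (auto simp: k_def)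
    have kC: "k - 1 \<in> C"
    proof (cases "k = Suc p")
      case False
      then have "k - 1 \<notin> D" using N[of "k - 1"] k by auto
      moreover have "k - 1 \<in> {1..n}" using k D pq False by fastforce
      ultimately show ?thesis using in_AD[of "k - 1"] by blast
    qed (use pC in simp)
    have "?x k < q"
    proof (rule ccontr)
      assume "\<not> ?thesis"
      then have "p < ?x k \<or> ?x k \<in> {q..p}" by auto
      then show False using N[of "?x k"] arc_down(1,2)[OF kC k(2)] pC by auto
    qed
    then have "k \<in> ?K" using k D by auto
    then show "?K \<noteq> {}" by blast
  qed
  have "card ?K = of_bool (?K \<noteq> {})"
  proof (cases "?K = {}")
    case False
    then obtain k where k: "k \<in> ?K" by blast
    have "?K = {k}"
    proof
      show "?K \<subseteq> {k}" using uniq[OF _ k] by blast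
    qed (use k in blast)
    then have "card ?K = 1" by (metis is_singletonI is_singleton_altdef)
    then show ?thesis using False by (simp only: of_bool_eq(2) not_False_eq_True)
  qed (simp only: card.empty simp_thms of_bool_eq)
  then show ?thesis unfolding lk_def ex .
qed

text \<open>The downward arc from \<open>j\<close> ends at the preceding downward cut, which can
  only be \<open>1\<close>. For \<open>j = 1\<close> the point has to be fixed instead, so the gap
  \<open>1\<close> must be uncrossed.\<close>

lemma arc_perm_eq_1:
  assumes j: "j \<in> D" "\<And>m. m \<in> D \<Longrightarrow> 1 < m \<Longrightarrow> j \<le> m" "j = 1 \<Longrightarrow> 1 \<notin> C" "j \<noteq> 1 \<Longrightarrow> j - 1 \<in> C"
  shows "arc_perm C A D j = 1"
proof (cases "j = 1")
  case True
  moreover have "0 \<notin> C" using C by auto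
  ultimately show ?thesis using arc_fixed[of j] j(3) by simp
next
  case False
  note d = arc_down[OF j(4)[OF False] j(1)]
  then show ?thesis using j(2)[of "arc_perm C A D j"] D by fastforce
qed

lemma arc_perm_eq_n:
  assumes i: "i \<in> A" "\<And>m. m \<in> A \<Longrightarrow> m < n \<Longrightarrow> m \<le> i" "i = n \<Longrightarrow> n - 1 \<notin> C" "i \<noteq> n \<Longrightarrow> i \<in> C"
  shows "arc_perm C A D i = n"
proof (cases "i = n")
  case True
  moreover have "n \<notin> C" using C by auto
  ultimately show ?thesis using arc_fixed[of i] i(3) by simp
next
  case False
  note d = arc_up[OF i(4)[OF False] i(1)]
  then show ?thesis using i(2)[of "arc_perm C A D i"] A by fastforce
qed

end

lemma arcs_rank_le:
  assumes "arcs n C A D" "arcs n C' A' D'" "C \<subseteq> C'" "A' \<subseteq> A" "D' \<subseteq> D"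
  shows "rank_le n (arc_perm C A D) (arc_perm C' A' D')"
proof (rule rank_leI[OF arcs.permutes arcs.permutes])
  fix p q assume "1 \<le> p" "p < q" "q \<le> n"
  then show "rk (arc_perm C A D) p q \<le> rk (arc_perm C' A' D') p q"
    using assms(3,4) by (auto simp: arcs.rk_eq[OF assms(1)] arcs.rk_eq[OF assms(2)])
next
  fix p q assume "1 \<le> q" "q \<le> p" "p < n"
  then show "lk n (arc_perm C A D) p q \<le> lk n (arc_perm C' A' D') p q"
    using assms(3,5) by (auto simp: arcs.lk_eq[OF assms(1)] arcs.lk_eq[OF assms(2)])
qed (use assms in auto)

section \<open>Positions of 1 and n in an interval\<close>

text \<open>
  For \<open>a < b\<close>, \<open>top_perm n a b\<close> is the minimal permutation with \<open>n\<close> in position \<open>a\<close> and \<open>1\<close> in position \<open>b\<close>.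
  The predicates \<open>pos_one\<close> and \<open>pos_top\<close> describe the positions that \<open>1\<close> and \<open>n\<close> can take in the Bruhat
  interval from \<open>u\<close> to it. The two choices are independent, except that the positions differ.
\<close>

definition top_perm :: "nat \<Rightarrow> nat \<Rightarrow> nat \<Rightarrow> nat \<Rightarrow> nat" where
  "top_perm n a b = arc_perm {1..<n} (insert n {1..a}) (insert 1 {b..n})"

definition pos_one :: "nat \<Rightarrow> nat \<Rightarrow> nat \<Rightarrow> (nat \<Rightarrow> nat) \<Rightarrow> nat \<Rightarrow> bool" where
  "pos_one n a b u j \<longleftrightarrow> j = b \<or>
     (1 \<le> j \<and> j < b \<and> (if j \<le> a then rk u j (Suc j) = 0 else lk n u j j = 0))"

definition pos_top :: "nat \<Rightarrow> nat \<Rightarrow> nat \<Rightarrow> (nat \<Rightarrow> nat) \<Rightarrow> nat \<Rightarrow> bool" where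
  "pos_top n a b u i \<longleftrightarrow> i = a \<or>
     (a < i \<and> i \<le> n \<and> (if b \<le> i then rk u (i - 1) i = 0 else rk u (i - 1) (Suc i) = 0))"

locale top_positions =
  fixes n a b :: nat
  assumes a: "1 \<le> a" and ab: "a < b" and b: "b \<le> n"
begin

text \<open>With every gap crossed, the common cuts must be just \<open>1\<close> and
  \<open>n\<close>; here \<open>a < b\<close> keeps \<open>{1..a}\<close> and \<open>{b..n}\<close>
  disjoint.\<close>

sublocale v: arcs n "{1..<n}" "insert n {1..a}" "insert 1 {b..n}"
  by unfold_locales (use a ab b in auto)

lemma top_permutes: "top_perm n a b permutes {1..n}"
  unfolding top_perm_def by (rule v.permutes)

lemma rk_top: "1 \<le> p \<Longrightarrow> p < q \<Longrightarrow> q \<le> n \<Longrightarrow>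
    rk (top_perm n a b) p q = of_bool (insert n {1..a} \<inter> {p<..<q} = {})"
  unfolding top_perm_def by (subst v.rk_eq) auto

lemma lk_top: "1 \<le> p \<Longrightarrow> 1 \<le> q \<Longrightarrow> q \<le> Suc p \<Longrightarrow> p < n \<Longrightarrow>
    lk n (top_perm n a b) p q = of_bool (insert 1 {b..n} \<inter> {q..p} = {})"
  unfolding top_perm_def by (subst v.lk_eq) auto

lemma rk_top_eq_0:
  assumes "1 \<le> p" "q \<le> n" "p < m" "m < q" "m \<le> a"
  shows "rk (top_perm n a b) p q = 0"
proof -
  have "m \<in> insert n {1..a} \<inter> {p<..<q}" using assms by auto
  then have "insert n {1..a} \<inter> {p<..<q} \<noteq> {}" by blast
  then show ?thesis using rk_top[of p q] assms by simp
qed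

lemma lk_top_eq_0:
  assumes "1 \<le> q" "p < n" "q \<le> m" "m \<le> p" "b \<le> m"
  shows "lk n (top_perm n a b) p q = 0"
proof -
  have "m \<in> insert 1 {b..n} \<inter> {q..p}" using assms by auto
  then have "insert 1 {b..n} \<inter> {q..p} \<noteq> {}" by blast
  then show ?thesis using lk_top[of p q] assms by simp
qed

lemma top_perm_b: "top_perm n a b b = 1"
  unfolding top_perm_def by (rule v.arc_perm_eq_1) (use a ab b in auto)

lemma top_perm_a: "top_perm n a b a = n"
  unfolding top_perm_def by (rule v.arc_perm_eq_n) (use a ab b in auto)

section \<open>Constraints on the positions of 1 and n below \<open>top_perm\<close>\<close>

context
  fixes x :: "nat \<Rightarrow> nat"
  assumes x: "x permutes {1..n}" and le: "rank_le n x (top_perm n a b)"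
begin

lemma rk_le_top: "p \<le> n \<Longrightarrow> rk x p q \<le> rk (top_perm n a b) p q"
  using le by (simp add: rank_le_def)

lemma lk_le_top: "p \<le> n \<Longrightarrow> 1 \<le> q \<Longrightarrow> q \<le> n \<Longrightarrow> lk n x p q \<le> lk n (top_perm n a b) p q"
  using rank_leD_lk[OF le x top_permutes] by simp

lemma rk_Suc_le_1: "1 \<le> p \<Longrightarrow> p < n \<Longrightarrow> rk x p (Suc p) \<le> 1"
  using rk_le_top[of p "Suc p"] rk_top[of p "Suc p"] by (simp add: of_bool_def split: if_splits)

lemma lk_Suc_le_1: "1 \<le> p \<Longrightarrow> p < n \<Longrightarrow> lk n x p (Suc p) \<le> 1"
  using rk_Suc_le_1[of p] rk_Suc_eq_lk[OF x, of p] by simp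

lemma one_pos_le:
  assumes "x j = 1" "1 \<le> j" "j \<le> n"
  shows "j \<le> b"
proof (rule ccontr)
  assume "\<not> j \<le> b"
  then have lt: "b < j" by simp
  then have "lk n (top_perm n a b) b 2 = 0" using a ab b assms by (intro lk_top_eq_0[of 2 b b]) auto
  then have "lk n x b 2 = 0" using lk_le_top[of b 2] a ab b by simp
  then show False using assms lt unfolding lk_eq_0_iff by force
qed

lemma n_pos_ge:
  assumes "x i = n" "1 \<le> i" "i \<le> n"
  shows "a \<le> i"
proof (rule ccontr)
  assume "\<not> a \<le> i"
  then have lt: "i < a" by simp
  then have "rk (top_perm n a b) i n = 0" using a ab b assms by (intro rk_top_eq_0[of i n a]) auto
  then have "rk x i n = 0" using rk_le_top[of i n] assms by simp
  then show False using assms unfolding rk_eq_0_iff by force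
qed

lemma below_a: "1 \<le> m \<Longrightarrow> m < a \<Longrightarrow> x m \<le> Suc m"
proof -
  assume m: "1 \<le> m" "m < a"
  have "rk (top_perm n a b) m (Suc (Suc m)) = 0" using m a ab b by (intro rk_top_eq_0[of m _ "Suc m"]) auto
  then have "rk x m (Suc (Suc m)) = 0" using rk_le_top[of m "Suc (Suc m)"] m ab b by simp
  then show ?thesis using m unfolding rk_eq_0_iff by force
qed

lemma above_b: "b < m \<Longrightarrow> m \<le> n \<Longrightarrow> m - 1 \<le> x m"
proof -
  assume m: "b < m" "m \<le> n"
  have "lk n (top_perm n a b) (m - 1) (m - 1) = 0" using m a ab b by (intro lk_top_eq_0[of _ _ "m - 1"]) auto
  then have "lk n x (m - 1) (m - 1) = 0" using lk_le_top[of "m - 1" "m - 1"] m a ab b by simp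
  then show ?thesis using m unfolding lk_eq_0_iff by force
qed

text \<open>By \<open>below_a\<close> no position before \<open>j\<close> holds a value above
  \<open>j\<close>, and \<open>j\<close> itself holds \<open>1\<close>.\<close>

lemma one_pos_low:
  assumes "x j = 1" "1 \<le> j" "j \<le> a"
  shows "rk x j (Suc j) = 0"
  unfolding rk_eq_0_iff
proof (intro allI impI)
  fix k assume k: "1 \<le> k" "k \<le> j"
  show "x k < Suc j"
  proof (cases "k = j")
    case False
    then show ?thesis using below_a[of k] k assms by simp
  qed (use assms in simp)
qed

text \<open>Position \<open>j\<close> already accounts for the single downward crossing of the gap
  \<open>j - 1\<close> that is allowed.\<close>

lemma one_pos_mid:
  assumes "x j = 1" "1 < j" "j \<le> n"
  shows "lk n x j j = 0"
proof -
  let ?K = "{k \<in> {j - 1<..n}. x k < Suc (j - 1)}"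
  have "card ?K \<le> 1" using lk_Suc_le_1[of "j - 1"] assms unfolding lk_def by simp
  moreover have "j \<in> ?K" using assms by simp
  moreover have "finite ?K" by simp
  ultimately have K: "k = j" if "k \<in> ?K" for k using that card_le_Suc0_iff_eq[of ?K] by simp
  show ?thesis unfolding lk_eq_0_iff
  proof (intro allI impI)
    fix k assume "j < k" "k \<le> n"
    then show "j \<le> x k" using K[of k] assms by fastforce
  qed
qed

text \<open>The bound \<open>above_b\<close> concerns the positions to the right of
  \<open>i\<close>, so it yields a statement on \<open>lk\<close>; the equality of the two counts at
  a gap turns it into one on \<open>rk\<close>.\<close>

lemma n_pos_high:
  assumes "x i = n" "b \<le> i" "i \<le> n"
  shows "rk x (i - 1) i = 0"
proof -
  have "lk n x (i - 1) i = 0"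
    unfolding lk_eq_0_iff
  proof (intro allI impI)
    fix k assume k: "i - 1 < k" "k \<le> n"
    show "i \<le> x k"
    proof (cases "k = i")
      case False
      then have "i \<le> k - 1" "b < k" using k assms(2) by linarith+
      then show ?thesis using above_b[of k] k(2) by simp
    qed (use assms in simp)
  qed
  then show ?thesis using rk_Suc_eq_lk[OF x, of "i - 1"] assms a ab by simp
qed

lemma n_pos_mid:
  assumes "x i = n" "1 \<le> i" "i < n"
  shows "rk x (i - 1) (Suc i) = 0"
proof -
  let ?K = "{k \<in> {1..i}. Suc i \<le> x k}"
  have "card ?K \<le> 1" using rk_Suc_le_1[of i] assms unfolding rk_def by simp
  moreover have "i \<in> ?K" using assms by simp
  moreover have "finite ?K" by simp
  ultimately have K: "k = i" if "k \<in> ?K" for k using that card_le_Suc0_iff_eq[of ?K] by simp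
  show ?thesis unfolding rk_eq_0_iff
  proof (intro allI impI)
    fix k assume "1 \<le> k" "k \<le> i - 1"
    then show "x k < Suc i" using K[of k] assms by fastforce
  qed
qed

lemma positions_necessary:
  assumes u: "u permutes {1..n}" and ux: "rank_le n u x"
  shows "x j = 1 \<Longrightarrow> 1 \<le> j \<Longrightarrow> j \<le> n \<Longrightarrow> pos_one n a b u j"
    and "x i = n \<Longrightarrow> 1 \<le> i \<Longrightarrow> i \<le> n \<Longrightarrow> pos_top n a b u i"
proof -
  have R: "rk x p q = 0 \<Longrightarrow> p \<le> n \<Longrightarrow> rk u p q = 0" for p q
    using ux by (metis le_zero_eq rank_le_def)
  have L: "lk n x p q = 0 \<Longrightarrow> p \<le> n \<Longrightarrow> 1 \<le> q \<Longrightarrow> q \<le> n \<Longrightarrow> lk n u p q = 0" for p q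
    using rank_leD_lk[OF ux u x] by (metis le_zero_eq)
  show "pos_one n a b u j" if j: "x j = 1" "1 \<le> j" "j \<le> n"
    using j one_pos_le[OF j] R[OF one_pos_low, of j] L[OF one_pos_mid, of j] a ab b by (auto simp: pos_one_def)
  show "pos_top n a b u i" if i: "x i = n" "1 \<le> i" "i \<le> n"
    using i n_pos_ge[OF i] R[OF n_pos_high, of i] R[OF n_pos_mid, of i] a ab b by (auto simp: pos_top_def)
qed

end

section \<open>Permutations in the interval with prescribed positions of 1 and n\<close>

context
  fixes u :: "nat \<Rightarrow> nat"
  assumes u: "u permutes {1..n}" and le: "rank_le n u (top_perm n a b)"
begin

text \<open>As \<open>u\<close> lies below \<open>top_perm\<close>, its counts in the tested ranges
  are at most those of \<open>top_perm\<close>, which are 0 or 1. Only the places where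
  \<open>top_perm\<close> has count 1 and the arc permutation has count 0 need an argument.\<close>

lemma rank_le_arcs:
  assumes "arcs n C A D"
    and A0: "\<And>p q. 1 \<le> p \<Longrightarrow> p < q \<Longrightarrow> q \<le> n \<Longrightarrow> insert n {1..a} \<inter> {p<..<q} = {} \<Longrightarrow>
      \<not> (p \<in> C \<and> A \<inter> {p<..<q} = {}) \<Longrightarrow> rk u p q = 0"
    and D0: "\<And>p q. 1 \<le> q \<Longrightarrow> q \<le> p \<Longrightarrow> p < n \<Longrightarrow> insert 1 {b..n} \<inter> {q..p} = {} \<Longrightarrow>
      \<not> (p \<in> C \<and> D \<inter> {q..p} = {}) \<Longrightarrow> lk n u p q = 0"
  shows "rank_le n u (arc_perm C A D)"
proof (rule rank_leI[OF u arcs.permutes[OF assms(1)]])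
  fix p q assume pq: "1 \<le> p" "p < q" "q \<le> n"
  show "rk u p q \<le> rk (arc_perm C A D) p q"
    using A0[OF pq] rk_le_top[OF u le, of p q] rk_top[OF pq] pq
    by (auto simp: arcs.rk_eq[OF assms(1) pq] of_bool_def split: if_splits)
next
  fix p q assume pq: "1 \<le> q" "q \<le> p" "p < n"
  have "lk n u p q \<le> lk n (top_perm n a b) p q" using lk_le_top[OF u le, of p q] pq by simp
  moreover have "lk n (top_perm n a b) p q = of_bool (insert 1 {b..n} \<inter> {q..p} = {})"
    using pq by (intro lk_top) auto
  moreover have "lk n (arc_perm C A D) p q = of_bool (p \<in> C \<and> D \<inter> {q..p} = {})"
    using pq by (intro arcs.lk_eq[OF assms(1)]) auto
  ultimately show "lk n u p q \<le> lk n (arc_perm C A D) p q"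
    using D0[OF pq] by (auto simp: of_bool_def split: if_splits)
qed

lemma rk0: "rk u p' q' = 0 \<Longrightarrow> p \<le> p' \<Longrightarrow> q' \<le> q \<Longrightarrow> rk u p q = 0"
  using rk_mono[of p p' q' q u] by simp

lemma lk0: "lk n u p' q' = 0 \<Longrightarrow> p' \<le> p \<Longrightarrow> q \<le> q' \<Longrightarrow> lk n u p q = 0"
  using lk_mono[of p' p q q' n u] by simp

lemma positions_sufficient_less:
  assumes i: "pos_top n a b u i" and j: "pos_one n a b u j" and ij: "i < j"
  shows "\<exists>x. x permutes {1..n} \<and> rank_le n u x \<and> rank_le n x (top_perm n a b) \<and> x i = n \<and> x j = 1"
proof -
  \<comment> \<open>All gaps stay crossed. The upward cut \<open>i\<close> is the last one before
    \<open>n\<close>, so \<open>i\<close> is sent to \<open>n\<close>; the downward cut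
    \<open>j\<close> is the first one after \<open>1\<close>, so \<open>j\<close> is sent to
    \<open>1\<close>.\<close>
  let ?A = "insert n (insert i {1..a})" and ?D = "insert 1 (insert j {b..n})"
  have ia: "a \<le> i" using i a by (auto simp: pos_top_def)
  have jb: "j \<le> b" using j by (auto simp: pos_one_def)
  interpret x: arcs n "{1..<n}" ?A ?D
    by unfold_locales (use a ab b ia jb ij in auto)
  have i0: "i \<noteq> a \<Longrightarrow> rk u (i - 1) (Suc i) = 0" using i jb ij by (auto simp: pos_top_def)
  have j0: "j \<noteq> b \<Longrightarrow> lk n u j j = 0" using j ia ij by (auto simp: pos_one_def)
  have "rank_le n u (arc_perm {1..<n} ?A ?D)"
  proof (rule rank_le_arcs[OF x.arcs_axioms])
    fix p q assume pq: "1 \<le> p" "p < q" "q \<le> n" "insert n {1..a} \<inter> {p<..<q} = {}"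
      "\<not> (p \<in> {1..<n} \<and> ?A \<inter> {p<..<q} = {})"
    have "i \<in> {p<..<q}" using pq by auto
    moreover have "a \<notin> {p<..<q}" using pq(4) a by (meson atLeastAtMost_iff disjoint_iff insertI2 order_refl)
    ultimately have ipq: "i \<in> {p<..<q}" "i \<noteq> a" by auto
    then show "rk u p q = 0" by (intro rk0[OF i0]) auto
  next
    fix p q assume pq: "1 \<le> q" "q \<le> p" "p < n" "insert 1 {b..n} \<inter> {q..p} = {}"
      "\<not> (p \<in> {1..<n} \<and> ?D \<inter> {q..p} = {})"
    have "j \<in> {q..p}" using pq by auto
    moreover have "b \<notin> {q..p}" using pq(4) b by (meson atLeastAtMost_iff disjoint_iff insertI2 order_refl)
    ultimately have ipq: "j \<in> {q..p}" "j \<noteq> b" by auto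
    then show "lk n u p q = 0" by (intro lk0[OF j0]) auto
  qed
  moreover have "rank_le n (arc_perm {1..<n} ?A ?D) (top_perm n a b)"
    unfolding top_perm_def by (rule arcs_rank_le[OF x.arcs_axioms v.arcs_axioms]) auto
  moreover have "arc_perm {1..<n} ?A ?D i = n"
    by (rule x.arc_perm_eq_n) (use a ab b ia jb ij in auto)
  moreover have "arc_perm {1..<n} ?A ?D j = 1"
    by (rule x.arc_perm_eq_1) (use a ab b ia jb ij in auto)
  ultimately show ?thesis using x.permutes by blast
qed

lemma positions_sufficient_greater:
  assumes i: "pos_top n a b u i" and j: "pos_one n a b u j" and ij: "j < i"
  shows "\<exists>x. x permutes {1..n} \<and> rank_le n u x \<and> rank_le n x (top_perm n a b) \<and> x i = n \<and> x j = 1"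
proof -
  \<comment> \<open>The cuts \<open>i\<close> and \<open>j\<close> may now collide with those of
    \<open>top_perm\<close>: \<open>j \<le> a\<close> is already an upward cut and
    \<open>i \<ge> b\<close> already a downward one. \<open>X\<close> collects the gaps left
    uncrossed to permit such double cuts, and \<open>E\<close> the end points of these gaps.\<close>
  define X where "X = (if j \<le> a then {j} else {}) \<union> (if b \<le> i then {i - 1} else {})"
  define C where "C = {1..<n} - X"
  define E where "E = X \<union> Suc ` X"
  define A where "A = insert n (insert i {1..a}) \<union> insert 1 E"
  define D where "D = insert 1 (insert j {b..n}) \<union> insert n E"
  have ia: "a \<le> i" "i \<le> n" using i ab b by (auto simp: pos_top_def)
  have jb: "j \<le> b" "1 \<le> j" using j a ab by (auto simp: pos_one_def)
  have X: "X \<subseteq> {1..<n}" using ia jb a ab b ij by (auto simp: X_def)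
  have bd: "{m \<in> {1..n}. m \<notin> C \<or> m - 1 \<notin> C} = insert 1 (insert n E)" (is "?l = ?r")
  proof
    show "?l \<subseteq> ?r"
    proof
      fix m assume m: "m \<in> ?l"
      then consider "m = n" | "m \<in> X" | "m = 1" | "m - 1 \<in> X" "m \<noteq> 0" by (force simp: C_def)
      then show "m \<in> ?r"
      proof cases
        case 4
        then have "m = Suc (m - 1)" by simp
        then have "m \<in> Suc ` X" using 4(1) by (rule image_eqI)
        then show ?thesis by (simp add: E_def)
      qed (auto simp: E_def)
    qed
    show "?r \<subseteq> ?l" using X a ab b by (auto simp: C_def E_def)
  qed
  have E: "m \<in> E \<Longrightarrow> j \<le> m \<and> m \<le> i" for m
    using ij jb by (auto simp: E_def X_def split: if_splits)
  have iE: "b \<le> i \<Longrightarrow> i \<in> E" and jE: "j \<le> a \<Longrightarrow> j \<in> E"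
    using ij by (force simp: E_def X_def)+
  interpret x: arcs n C A D
  proof
    show "C \<subseteq> {1..<n}" by (auto simp: C_def)
    show "A \<subseteq> {1..n}" "D \<subseteq> {1..n}" using E a ab b ia jb ij by (fastforce simp: A_def D_def)+
    have "insert n (insert i {1..a}) \<inter> insert 1 (insert j {b..n}) \<subseteq> insert 1 (insert n E)"
      using iE jE ab ij by auto
    then show "A \<inter> D = {m \<in> {1..n}. m \<notin> C \<or> m - 1 \<notin> C}"
      unfolding bd A_def D_def using a b ab by auto
  qed
  have i0: "\<not> b \<le> i \<Longrightarrow> i \<noteq> a \<Longrightarrow> rk u (i - 1) (Suc i) = 0" and i1: "b \<le> i \<Longrightarrow> rk u (i - 1) i = 0"
    using i ab by (auto simp: pos_top_def)
  have j0: "\<not> j \<le> a \<Longrightarrow> j \<noteq> b \<Longrightarrow> lk n u j j = 0" and j1: "j \<le> a \<Longrightarrow> rk u j (Suc j) = 0"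
    using j ab by (auto simp: pos_one_def)
  have X0: "rk u m (Suc m) = 0" "lk n u m (Suc m) = 0" if "m \<in> X" for m
  proof -
    show "rk u m (Suc m) = 0" using that i1 j1 ij by (auto simp: X_def split: if_splits)
    then show "lk n u m (Suc m) = 0" using rk_Suc_eq_lk[OF u, of m] that X by auto
  qed
  have "rank_le n u (arc_perm C A D)"
  proof (rule rank_le_arcs[OF x.arcs_axioms])
    fix p q assume pq: "1 \<le> p" "p < q" "q \<le> n" "insert n {1..a} \<inter> {p<..<q} = {}"
      "\<not> (p \<in> C \<and> A \<inter> {p<..<q} = {})"
    have EX: "\<exists>m'\<in>X. p \<le> m' \<and> m' < q" if "m \<in> E" "m \<in> {p<..<q}" for m
      using that by (auto simp: E_def less_Suc_eq_le intro: less_imp_le Suc_lessD)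
    \<comment> \<open>A count lost against \<open>top_perm\<close> is due to an uncrossed gap in the
      range or to the new cut \<open>i\<close>. In either case the assumptions on the positions and
      monotonicity make the count of \<open>u\<close> zero.\<close>
    consider m where "m \<in> X" "p \<le> m" "m < q" | "i \<in> {p<..<q}" "i \<notin> E"
    proof (cases "p \<in> C")
      case False
      then have "p \<in> X" using pq(1-3) by (simp add: C_def)
      then show ?thesis using that(1) pq(2) by blast
    next
      case True
      then obtain m where m: "m \<in> A" "m \<in> {p<..<q}" using pq(5) by blast
      then have "m \<notin> insert n {1..a}" using pq(4) by blast
      moreover have "m \<noteq> 1" using m(2) pq(1) by simp
      ultimately have "m = i \<or> m \<in> E" using m(1) unfolding A_def by blast
      then show ?thesis using that EX m(2) by blast
    qed
    then show "rk u p q = 0"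
    proof cases
      case 1
      then show ?thesis by (intro rk0[OF X0(1)]) auto
    next
      case 2
      have "a \<notin> {p<..<q}" using pq(4) a by (meson atLeastAtMost_iff disjoint_iff insertI2 order_refl)
      then have "i \<noteq> a" using 2 by auto
      then show ?thesis using 2 iE by (intro rk0[OF i0]) auto
    qed
  next
    fix p q assume pq: "1 \<le> q" "q \<le> p" "p < n" "insert 1 {b..n} \<inter> {q..p} = {}"
      "\<not> (p \<in> C \<and> D \<inter> {q..p} = {})"
    have EX: "\<exists>m'\<in>X. q \<le> Suc m' \<and> m' \<le> p" if "m \<in> E" "m \<in> {q..p}" for m
      using that by (auto simp: E_def intro: le_SucI)
    consider m where "m \<in> X" "q \<le> Suc m" "m \<le> p" | "j \<in> {q..p}" "j \<notin> E"
    proof (cases "p \<in> C")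
      case False
      then have "p \<in> X" using pq(1-3) by (simp add: C_def)
      then show ?thesis using that(1)[of p] pq(2) by simp
    next
      case True
      then obtain m where m: "m \<in> D" "m \<in> {q..p}" using pq(5) by blast
      then have "m \<notin> insert 1 {b..n}" using pq(4) by blast
      moreover have "m \<noteq> n" using m(2) pq(3) by simp
      ultimately have "m = j \<or> m \<in> E" using m(1) unfolding D_def by blast
      then show ?thesis using that EX m(2) by blast
    qed
    then show "lk n u p q = 0"
    proof cases
      case 1
      then show ?thesis by (intro lk0[OF X0(2)]) auto
    next
      case 2
      have "b \<notin> {q..p}" using pq(4) b by (meson atLeastAtMost_iff disjoint_iff insertI2 order_refl)
      then have "j \<noteq> b" using 2 by auto
      then show ?thesis using 2 jE by (intro lk0[OF j0]) auto
    qed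
  qed
  moreover have "rank_le n (arc_perm C A D) (top_perm n a b)"
    unfolding top_perm_def
    by (rule arcs_rank_le[OF x.arcs_axioms v.arcs_axioms]) (auto simp: A_def C_def D_def)
  moreover have "arc_perm C A D i = n"
  proof (rule x.arc_perm_eq_n)
    show "i \<in> A" by (simp add: A_def)
    show "m \<le> i" if "m \<in> A" "m < n" for m using that E[of m] ia ij jb by (auto simp: A_def)
    show "n - 1 \<notin> C" if "i = n" using that b by (simp add: C_def X_def)
    show "i \<in> C" if "i \<noteq> n" using that ia a ij by (auto simp: C_def X_def)
  qed
  moreover have "arc_perm C A D j = 1"
  proof (rule x.arc_perm_eq_1)
    show "j \<in> D" by (simp add: D_def)
    show "j \<le> m" if "m \<in> D" "1 < m" for m using that E[of m] ia ij jb by (auto simp: D_def)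
    show "1 \<notin> C" if "j = 1" using that a by (simp add: C_def X_def)
    show "j - 1 \<in> C" if "j \<noteq> 1" using that ia jb ij by (auto simp: C_def X_def)
  qed
  ultimately show ?thesis using x.permutes by blast
qed

theorem positions_iff:
  "(\<exists>x. x permutes {1..n} \<and> rank_le n u x \<and> rank_le n x (top_perm n a b) \<and> x i = n \<and> x j = 1) \<longleftrightarrow>
     i \<noteq> j \<and> pos_top n a b u i \<and> pos_one n a b u j"
proof
  assume "\<exists>x. x permutes {1..n} \<and> rank_le n u x \<and> rank_le n x (top_perm n a b) \<and> x i = n \<and> x j = 1"
  then obtain x where x: "x permutes {1..n}" "rank_le n u x" "rank_le n x (top_perm n a b)" "x i = n" "x j = 1"
    by blast
  have "i \<in> {1..n}" "j \<in> {1..n}" using permutes_in_image[OF x(1)] x(4,5) a ab b by fastforce+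
  then show "i \<noteq> j \<and> pos_top n a b u i \<and> pos_one n a b u j"
    using positions_necessary[OF x(1,3) u x(2)] x(4,5) a ab b by auto
next
  assume "i \<noteq> j \<and> pos_top n a b u i \<and> pos_one n a b u j"
  then show "\<exists>x. x permutes {1..n} \<and> rank_le n u x \<and> rank_le n x (top_perm n a b) \<and> x i = n \<and> x j = 1"
    using positions_sufficient_less positions_sufficient_greater by (cases i j rule: linorder_cases) auto
qed

end

end

section \<open>Uncrossed gaps and adjacent common positions\<close>

context top_positions
begin

text \<open>Every count in \<open>pos_top\<close> or \<open>pos_one\<close> at an end of the gap
  \<open>p\<close> is bounded by \<open>rk\<close> or \<open>lk\<close> at the gap itself, and these
  two agree and vanish.\<close>

lemma both_positions:
  assumes u: "u permutes {1..n}" and p: "a \<le> p" "p < b" and r: "rk u p (Suc p) = 0"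
  shows "pos_top n a b u p" "pos_one n a b u p" "pos_top n a b u (Suc p)" "pos_one n a b u (Suc p)"
proof -
  have l: "lk n u p (Suc p) = 0" using rk_Suc_eq_lk[OF u, of p] r p b by simp
  note R = rk_mono[of _ p "Suc p" _ u, unfolded r le_zero_eq] and L = lk_mono[of p _ _ "Suc p" n u, unfolded l le_zero_eq]
  show "pos_top n a b u p" using p b R[of "p - 1" "Suc p"] by (auto simp: pos_top_def)
  show "pos_one n a b u p" using p a r L[of p p] by (auto simp: pos_one_def)
  show "pos_top n a b u (Suc p)" using p b r R[of p "Suc (Suc p)"] by (auto simp: pos_top_def)
  show "pos_one n a b u (Suc p)" using p b L[of "Suc p" "Suc p"] by (auto simp: pos_one_def)
qed

text \<open>If both gaps next to \<open>j\<close> were crossed, the vanishing counts would force the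
  upward crossing of the left gap and the downward crossing of the right gap to end at
  \<open>j\<close>, against injectivity.\<close>

lemma not_isolated:
  assumes u: "u permutes {1..n}" and j: "pos_top n a b u j" "pos_one n a b u j"
  shows "(1 \<le> j - 1 \<and> pos_top n a b u (j - 1) \<and> pos_one n a b u (j - 1)) \<or>
    (Suc j \<le> n \<and> pos_top n a b u (Suc j) \<and> pos_one n a b u (Suc j))"
proof -
  have jab: "a \<le> j" "j \<le> b" using j ab by (auto simp: pos_top_def pos_one_def)
  have "(a \<le> j - 1 \<and> a < j \<and> rk u (j - 1) j = 0) \<or> (j < b \<and> rk u j (Suc j) = 0)"
  proof (rule ccontr)
    assume neg: "\<not> ?thesis"
    \<comment> \<open>At \<open>a\<close> the condition \<open>pos_one\<close>, and at
      \<open>b\<close> the condition \<open>pos_top\<close>, says outright that an adjacent gap is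
      uncrossed.\<close>
    have "j \<noteq> a" using neg j(2) ab by (auto simp: pos_one_def)
    moreover have "j \<noteq> b" using neg j(1) ab by (auto simp: pos_top_def)
    ultimately have lt: "a < j" "j < b" using jab by auto
    have z: "rk u (j - 1) (Suc j) = 0" "lk n u j j = 0" using lt j by (auto simp: pos_top_def pos_one_def)
    have nz: "rk u (j - 1) j \<noteq> 0" "rk u j (Suc j) \<noteq> 0" using neg lt by auto
    from nz(1) obtain k where k: "1 \<le> k" "k \<le> j - 1" "j \<le> u k" unfolding rk_eq_0_iff by (auto simp: not_less)
    have "u k = j" using z(1) k unfolding rk_eq_0_iff by force
    have "lk n u j (Suc j) \<noteq> 0" using nz(2) rk_Suc_eq_lk[OF u, of j] lt b by simp
    then obtain l where l: "j < l" "l \<le> n" "u l \<le> j" unfolding lk_eq_0_iff by (auto simp: not_le)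
    have "u l = j" using z(2) l unfolding lk_eq_0_iff by force
    then have "k = l" using \<open>u k = j\<close> permutes_inj[OF u] by (metis injD)
    then show False using k l by simp
  qed
  then show ?thesis
  proof
    assume *: "a \<le> j - 1 \<and> a < j \<and> rk u (j - 1) j = 0"
    then have "j - 1 < b" "Suc (j - 1) = j" "1 \<le> j - 1" using jab a by linarith+
    then show ?thesis using both_positions(1,2)[OF u, of "j - 1"] * by simp
  next
    assume "j < b \<and> rk u j (Suc j) = 0"
    then show ?thesis using both_positions[OF u, of j] jab b by auto
  qed
qed

lemma exists_bottom:
  assumes S: "S \<subseteq> {1..n}" "a \<in> S" "\<And>i. i \<in> S \<Longrightarrow> a \<le> i"
    and T: "T \<subseteq> {1..n}" "b \<in> T" "\<And>j. j \<in> T \<Longrightarrow> j \<le> b"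
    and iso: "\<And>m. m \<in> S \<Longrightarrow> m \<in> T \<Longrightarrow> (m - 1 \<in> S \<and> m - 1 \<in> T) \<or> (Suc m \<in> S \<and> Suc m \<in> T)"
  shows "\<exists>u. u permutes {1..n} \<and> rank_le n u (top_perm n a b) \<and>
    (\<forall>i. pos_top n a b u i \<longleftrightarrow> i \<in> S) \<and> (\<forall>j. pos_one n a b u j \<longleftrightarrow> j \<in> T)"
proof -
  let ?B = "\<lambda>p. p \<in> S \<and> p \<in> T"
  \<comment> \<open>The gaps between adjacent stars must not be crossed: \<open>pos_top\<close> and \<open>pos_one\<close> both hold at a point strictly
    between \<open>a\<close> and \<open>b\<close> only if one of its two neighbouring gaps is uncrossed.\<close>
  define C where "C = {p \<in> {1..<n}. if p < a then p \<notin> T else if p < b then \<not> (?B p \<and> ?B (Suc p)) else Suc p \<notin> S}"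
  define E where "E = {m \<in> {1..n}. m \<notin> C \<or> m - 1 \<notin> C}"
  \<comment> \<open>Strictly between \<open>a\<close> and \<open>b\<close> the cuts record
    membership in \<open>S\<close> and \<open>T\<close>. Including \<open>{1..a}\<close> and
    \<open>{b..n}\<close> places \<open>u\<close> below \<open>top_perm\<close>.\<close>
  define A where "A = E \<union> (S \<inter> {a<..<b}) \<union> {1..a}"
  define D where "D = E \<union> (T \<inter> {a<..<b}) \<union> {b..n}"
  \<comment> \<open>Left of \<open>a\<close> and from \<open>b\<close> on, gaps encode the sets: the
    gap \<open>p\<close> decides \<open>p \<in> T\<close> on the left and
    \<open>Suc p \<in> S\<close> on the right, matching the branches of \<open>pos_one\<close> and
    \<open>pos_top\<close> that test a single gap.\<close>
  have Clow: "p \<in> C \<longleftrightarrow> p \<notin> T" if "1 \<le> p" "p < a" for p using that ab b by (auto simp: C_def)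
  have Cmid: "p \<in> C \<longleftrightarrow> \<not> (?B p \<and> ?B (Suc p))" if "a \<le> p" "p < b" for p using that a b by (auto simp: C_def)
  have Chigh: "p \<in> C \<longleftrightarrow> Suc p \<notin> S" if "b \<le> p" "p < n" for p using that a ab by (auto simp: C_def)
  \<comment> \<open>The absence of isolated stars enters here: a common point has a common
    neighbour, the gap between them is uncrossed, and so the point lies in \<open>E\<close>. This
    gives \<open>A \<inter> D = E\<close>.\<close>
  have Bmid: "?B m \<longleftrightarrow> m \<in> E" if m: "a < m" "m < b" for m
  proof
    assume B: "?B m"
    then consider "?B (m - 1)" | "?B (Suc m)" using iso by blast
    then show "m \<in> E"
    proof cases
      case 1
      then have "m - 1 \<notin> C" using Cmid[of "m - 1"] B m by auto
      then show ?thesis using m a b by (auto simp: E_def)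
    next
      case 2
      then have "m \<notin> C" using Cmid[of m] B m by auto
      then show ?thesis using m a b by (auto simp: E_def)
    qed
  next
    assume "m \<in> E"
    then show "?B m" using Cmid[of m] Cmid[of "m - 1"] m by (auto simp: E_def)
  qed
  interpret u: arcs n C A D
  proof
    show "C \<subseteq> {1..<n}" by (auto simp: C_def)
    show "A \<subseteq> {1..n}" "D \<subseteq> {1..n}" using a ab b by (auto simp: A_def D_def E_def)
    have "m \<in> E" if "m \<in> A" "m \<in> D" for m
      using that Bmid[of m] ab by (auto simp: A_def D_def)
    moreover have "E \<subseteq> A" "E \<subseteq> D" by (auto simp: A_def D_def)
    ultimately have "A \<inter> D = E" by blast
    then show "A \<inter> D = {m \<in> {1..n}. m \<notin> C \<or> m - 1 \<notin> C}" by (simp add: E_def)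
  qed
  let ?u = "arc_perm C A D"
  have rk_Suc: "rk ?u p (Suc p) = 0 \<longleftrightarrow> p \<notin> C" if "1 \<le> p" "p < n" for p
    using u.rk_eq[of p "Suc p"] that by (auto simp: of_bool_def split: if_splits)
  have "rank_le n ?u (top_perm n a b)"
    unfolding top_perm_def
  proof (rule arcs_rank_le[OF u.arcs_axioms v.arcs_axioms])
    show "C \<subseteq> {1..<n}" by (auto simp: C_def)
    have "n \<in> E" "1 \<in> E" using a ab b by (auto simp: E_def C_def)
    then show "insert n {1..a} \<subseteq> A" "insert 1 {b..n} \<subseteq> D" by (auto simp: A_def D_def)
  qed
  moreover have "pos_one n a b ?u j \<longleftrightarrow> j \<in> T" for j
  proof -
    consider "j = 0 \<or> b < j" | "j = b" | "1 \<le> j" "j < a" | "j = a" | "a < j" "j < b" by linarith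
    then show ?thesis
    proof cases
      case 1
      then show ?thesis using T(1) T(3)[of j] ab by (auto simp: pos_one_def)
    next
      case 2
      then show ?thesis using T(2) by (simp add: pos_one_def)
    next
      case 3
      then show ?thesis using rk_Suc[of j] Clow[of j] ab b by (auto simp: pos_one_def)
    next
      case 4
      \<comment> \<open>The common neighbour of \<open>a\<close> must be on its right, since
        \<open>a\<close> is the least element of \<open>S\<close>.\<close>
      have "a \<in> T \<Longrightarrow> ?B (Suc a)" using iso[of a] S(2) S(3)[of "a - 1"] a by auto
      then have "a \<notin> C \<longleftrightarrow> a \<in> T" using Cmid[of a] ab S(2) by auto
      then show ?thesis using 4 rk_Suc[of a] a ab b by (auto simp: pos_one_def)
    next
      case 5
      then have "lk n ?u j j = of_bool (j \<in> C \<and> D \<inter> {j..j} = {})"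
        using a ab b by (intro u.lk_eq) auto
      then have "lk n ?u j j = 0 \<longleftrightarrow> j \<in> D"
        using 5 a b by (auto simp: of_bool_def D_def E_def split: if_splits)
      also have "\<dots> \<longleftrightarrow> j \<in> T" using 5 Bmid[of j] by (auto simp: D_def)
      finally show ?thesis using 5 a by (auto simp: pos_one_def)
    qed
  qed
  moreover have "pos_top n a b ?u i \<longleftrightarrow> i \<in> S" for i
  proof -
    consider "i < a \<or> n < i" | "i = a" | "b < i" "i \<le> n" | "i = b" | "a < i" "i < b" by linarith
    then show ?thesis
    proof cases
      case 1
      then show ?thesis using S(1) S(3)[of i] ab b by (auto simp: pos_top_def)
    next
      case 2
      then show ?thesis using S(2) by (simp add: pos_top_def)
    next
      case 3
      then show ?thesis using rk_Suc[of "i - 1"] Chigh[of "i - 1"] a ab b by (auto simp: pos_top_def)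
    next
      case 4
      have "b \<in> S \<Longrightarrow> ?B (b - 1)" using iso[of b] T(2) T(3)[of "Suc b"] by auto
      then have "b - 1 \<notin> C \<longleftrightarrow> b \<in> S" using Cmid[of "b - 1"] ab T(2) by auto
      then show ?thesis using 4 rk_Suc[of "b - 1"] a ab b by (auto simp: pos_top_def)
    next
      case 5
      then have "rk ?u (i - 1) (Suc i) = of_bool (i - 1 \<in> C \<and> A \<inter> {i - 1<..<Suc i} = {})"
        using a ab b by (intro u.rk_eq) auto
      moreover have "{i - 1<..<Suc i} = {i}" using 5 by auto
      ultimately have "rk ?u (i - 1) (Suc i) = 0 \<longleftrightarrow> i \<in> A"
        using 5 a b by (auto simp: of_bool_def A_def E_def split: if_splits)
      also have "\<dots> \<longleftrightarrow> i \<in> S" using 5 Bmid[of i] by (auto simp: A_def)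
      finally show ?thesis using 5 b by (auto simp: pos_top_def)
    qed
  qed
  ultimately show ?thesis using u.permutes by blast
qed

section \<open>Minimal permutations\<close>

lemma top_perm_low: "1 \<le> k \<Longrightarrow> k < a \<Longrightarrow> top_perm n a b k = Suc k"
  unfolding top_perm_def using v.arc_up(1)[of k] v.arc_up(3)[of k "Suc k"] ab b by fastforce

lemma top_perm_mid: "a < k \<Longrightarrow> k < b \<Longrightarrow> top_perm n a b k = k"
  unfolding top_perm_def by (rule v.arc_fixed) (use a b in auto)

lemma top_perm_high: "b < k \<Longrightarrow> k \<le> n \<Longrightarrow> top_perm n a b k = k - 1"
  unfolding top_perm_def using v.arc_down(1)[of k] v.arc_down(3)[of k "k - 1"] a ab by fastforce

lemma inv_top_perm:
  assumes "2 \<le> q" "q < n"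
  shows "inv (top_perm n a b) q = (if q \<le> a then q - 1 else if q < b then q else Suc q)"
proof -
  have "top_perm n a b (if q \<le> a then q - 1 else if q < b then q else Suc q) = q"
    using top_perm_low[of "q - 1"] top_perm_mid[of q] top_perm_high[of "Suc q"] assms by auto
  then show ?thesis using permutes_inv_eq[OF top_permutes] by metis
qed

text \<open>While two consecutive values strictly between \<open>1\<close> and \<open>n\<close> are
  out of order, swapping them lowers \<open>x\<close> and leaves \<open>1\<close> and
  \<open>n\<close> in place. Once there are none, \<open>x\<close> is
  \<open>top_perm\<close>.\<close>

lemma top_rank_le:
  assumes "x permutes {1..n}" "x a = n" "x b = 1"
  shows "rank_le n (top_perm n a b) x"
  using assms
proof (induction "card (inversions n x)" arbitrary: x rule: less_induct)
  case less
  note x = less.prems(1)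
  show ?case
  proof (cases "\<exists>i. 2 \<le> i \<and> Suc i < n \<and> \<not> inv x i < inv x (Suc i)")
    case False
    have "inv x q = inv (top_perm n a b) q" if "q \<in> {1..n} - {2..<n}" for q
    proof -
      have "q = 1 \<or> q = n" using that by auto
      then show ?thesis
        using permutes_inv_eq[OF x] permutes_inv_eq[OF top_permutes] less.prems top_perm_a top_perm_b by metis
    qed
    then have "x = top_perm n a b"
      using False by (intro permutes_no_descent_eq[OF x top_permutes, of 2 n]) (auto simp: inv_top_perm)
    then show ?thesis by simp
  next
    case True
    then obtain i where i: "2 \<le> i" "Suc i < n" "\<not> inv x i < inv x (Suc i)" by blast
    let ?c = "inv x i" and ?d = "inv x (Suc i)"
    have i': "i \<in> {1..<n}" using i by auto
    have c: "x ?c = i" "x ?d = Suc i" using permutes_inverses(1)[OF x] by auto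
    have r: "?c \<in> {1..n}" "?d \<in> {1..n}" using i permutes_in_image[OF permutes_inv[OF x]] by auto
    have "?c \<noteq> ?d" using c by auto
    then have dc: "?d < ?c" using i by auto
    let ?y = "adj i \<circ> x"
    have y: "?y permutes {1..n}" using adj_comp_permutes[OF x i'] .
    have "?y a = n" "?y b = 1" using less.prems i by (auto simp: transpose_def)
    then have "rank_le n (top_perm n a b) ?y"
      using less.hyps[of ?y] card_inversions_adj_descent[OF x r c dc i'] y by simp
    moreover have "rank_le n ?y (adj i \<circ> ?y)"
      using c dc r by (intro rank_le_adj(2)[OF y y, of ?d ?c i ?d ?c]) auto
    then have "rank_le n ?y x" by (simp add: comp_assoc[symmetric])
    ultimately show ?thesis by (rule rank_le_trans)
  qed
qed

text \<open>\<open>pi_vec\<close> records precisely the positions of \<open>1\<close> and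
  \<open>n\<close>, and by \<open>top_rank_le\<close> the least permutation with these positions is
  \<open>top_perm\<close>.\<close>

lemma minimal_perm_iff:
  assumes "x permutes {1..n}" "x a = n" "x b = 1"
  shows "minimal_perm n x \<longleftrightarrow> x = top_perm n a b"
proof
  have n: "n \<noteq> 1" using a ab b by simp
  have rng: "a \<in> {1..n}" "b \<in> {1..n}" using a ab b by auto
  show "x = top_perm n a b" if min: "minimal_perm n x"
  proof -
    have t: "k \<in> {1..n} \<Longrightarrow> top_perm n a b k = n \<longleftrightarrow> k = a" "top_perm n a b k = 1 \<longleftrightarrow> k = b" for k
      using permutes_inj[OF top_permutes] top_perm_a top_perm_b by (metis injD)+
    have t': "x k = n \<longleftrightarrow> k = a" "x k = 1 \<longleftrightarrow> k = b" for k
      using permutes_inj[OF assms(1)] assms(2,3) by (metis injD)+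
    have "pi_vec n (top_perm n a b) = pi_vec n x"
      unfolding pi_vec_def by (rule ext) (use t t' in simp)
    then show ?thesis
      using min top_rank_le[OF assms] top_permutes assms(1)
      unfolding minimal_perm_def bruhat_le_iff_rank_le Sym_def by blast
  qed
  show "minimal_perm n x" if x: "x = top_perm n a b"
    unfolding minimal_perm_def
  proof (intro conjI notI)
    show "x \<in> Sym n" using assms by (simp add: Sym_def)
    assume "\<exists>y\<in>Sym n. pi_vec n y = pi_vec n x \<and> bruhat_le n y x \<and> y \<noteq> x"
    then obtain y where y: "y permutes {1..n}" "pi_vec n y = pi_vec n x" "rank_le n y x" "y \<noteq> x"
      by (auto simp: Sym_def bruhat_le_iff_rank_le)
    have "y a = n" using fun_cong[OF y(2), of a] rng assms n by (auto simp: pi_vec_def split: if_splits)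
    moreover have "y b = 1" using fun_cong[OF y(2), of b] rng assms n by (auto simp: pi_vec_def split: if_splits)
    ultimately have "rank_le n x y" using top_rank_le[OF y(1)] x by simp
    then show False using rank_le_antisym[OF y(1) assms(1) y(3)] y(4) by simp
  qed
qed

end

section \<open>Convex hulls\<close>

lemma conv_hull_finiteI:
  fixes c :: "'i \<Rightarrow> real"
  assumes "finite I" "\<And>i. i \<in> I \<Longrightarrow> 0 \<le> c i" "\<And>i. i \<in> I \<Longrightarrow> p i \<in> V" "sum c I = 1"
  shows "(\<lambda>j. \<Sum>i\<in>I. c i * p i j) \<in> conv_hull V"
proof -
  obtain h where h: "bij_betw h {0..<card I} I" using ex_bij_betw_nat_finite[OF assms(1)] by blast
  then have h': "bij_betw h {..<card I} I" by (simp add: atLeast0LessThan)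
  have mem: "h i \<in> I" if "i < card I" for i using bij_betwE[OF h'] that by simp
  have "(\<Sum>i<card I. c (h i)) = 1" using sum.reindex_bij_betw[OF h', of c] assms(4) by simp
  moreover have "(\<Sum>i\<in>I. c i * p i j) = (\<Sum>i<card I. c (h i) * p (h i) j)" for j
    using sum.reindex_bij_betw[OF h', of "\<lambda>i. c i * p i j"] by simp
  ultimately show ?thesis
    unfolding conv_hull_def mem_Collect_eq
    by (intro exI[of _ "card I"] exI[of _ "\<lambda>i. c (h i)"] exI[of _ "\<lambda>i. p (h i)"]) (auto simp: assms(2,3) mem)
qed

lemma conv_hullE:
  assumes "y \<in> conv_hull V"
  obtains k :: nat and c p where "\<And>i. i < k \<Longrightarrow> 0 \<le> c i" "\<And>i. i < k \<Longrightarrow> p i \<in> V" "(\<Sum>i<k. c i) = (1::real)"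
    "y = (\<lambda>j. \<Sum>i<k. c i * p i j)"
  using assms unfolding conv_hull_def by blast

lemma conv_hull_superset: "V \<subseteq> conv_hull V"
proof
  fix y assume "y \<in> V"
  then show "y \<in> conv_hull V"
    using conv_hull_finiteI[of "{()}" "\<lambda>_. 1" "\<lambda>_. y" V] by simp
qed

lemma conv_hull_conv_hull: "conv_hull (conv_hull V) = conv_hull V"
proof
  show "conv_hull (conv_hull V) \<subseteq> conv_hull V"
  proof
    fix y assume "y \<in> conv_hull (conv_hull V)"
    then obtain k :: nat and c p where c: "\<And>i. i < k \<Longrightarrow> 0 \<le> c i" and p: "\<And>i. i < k \<Longrightarrow> p i \<in> conv_hull V"
      and s: "(\<Sum>i<k. c i) = 1" and y: "y = (\<lambda>j. \<Sum>i<k. c i * p i j)"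
      by (rule conv_hullE) blast
    define Q where "Q i l d q \<longleftrightarrow> (\<forall>t<l. 0 \<le> d t \<and> q t \<in> V) \<and> (\<Sum>t<l. d t) = 1 \<and>
        p i = (\<lambda>j. \<Sum>t<(l::nat). d t * q t j)" for i l d q
    have "\<forall>i. \<exists>l d q. i < k \<longrightarrow> Q i l d q"
      using p unfolding conv_hull_def Q_def by blast
    then obtain l d q where "\<forall>i. i < k \<longrightarrow> Q i (l i) (d i) (q i)" by metis
    then have ldq: "(\<forall>t<l i. 0 \<le> d i t \<and> q i t \<in> V) \<and> (\<Sum>t<l i. d i t) = 1 \<and>
        p i = (\<lambda>j. \<Sum>t<l i. d i t * q i t j)" if "i < k" for i
      using that unfolding Q_def by blast
    let ?I = "Sigma {..<k} (\<lambda>i. {..<l i})"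
    have "(\<lambda>j. \<Sum>z\<in>?I. (c (fst z) * d (fst z) (snd z)) * q (fst z) (snd z) j) \<in> conv_hull V"
    proof (rule conv_hull_finiteI)
      have "(\<Sum>z\<in>?I. c (fst z) * d (fst z) (snd z)) = (\<Sum>i<k. \<Sum>t<l i. c i * d i t)"
        by (subst sum.Sigma) (auto simp: split_def)
      also have "\<dots> = (\<Sum>i<k. c i)" using ldq by (intro sum.cong) (auto simp: sum_distrib_left[symmetric])
      finally show "(\<Sum>z\<in>?I. c (fst z) * d (fst z) (snd z)) = 1" using s by simp
    qed (use c ldq in auto)
    moreover have "(\<Sum>z\<in>?I. (c (fst z) * d (fst z) (snd z)) * q (fst z) (snd z) j) = y j" for j
    proof -
      have "(\<Sum>z\<in>?I. (c (fst z) * d (fst z) (snd z)) * q (fst z) (snd z) j) = (\<Sum>i<k. \<Sum>t<l i. c i * d i t * q i t j)"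
        by (subst sum.Sigma) (auto simp: split_def)
      also have "\<dots> = (\<Sum>i<k. c i * p i j)"
        using ldq by (intro sum.cong) (auto simp: sum_distrib_left mult.assoc)
      finally show ?thesis by (simp add: y)
    qed
    ultimately show "y \<in> conv_hull V" by simp
  qed
qed (rule conv_hull_superset)

text \<open>Products of coefficients write a sum of two convex combinations as a convex combination
  of sums of points. These sums need only lie in the hull of \<open>U\<close>: in the application
  the sum with \<open>i = j\<close> is not a point of \<open>U\<close>.\<close>

lemma minkowski_sum_conv_hull_subset:
  assumes "\<And>p q. p \<in> V \<Longrightarrow> q \<in> W \<Longrightarrow> (\<lambda>j. p j + q j) \<in> conv_hull U"
  shows "minkowski_sum (conv_hull V) (conv_hull W) \<subseteq> conv_hull U"
proof
  fix y assume "y \<in> minkowski_sum (conv_hull V) (conv_hull W)"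
  then obtain f g where fg: "f \<in> conv_hull V" "g \<in> conv_hull W" "y = (\<lambda>j. f j + g j)"
    by (auto simp: minkowski_sum_def)
  obtain k :: nat and c p where c: "\<And>i. i < k \<Longrightarrow> 0 \<le> c i" and p: "\<And>i. i < k \<Longrightarrow> p i \<in> V"
    and s: "(\<Sum>i<k. c i) = 1" and f: "f = (\<lambda>j. \<Sum>i<k. c i * p i j)"
    using conv_hullE[OF fg(1)] by blast
  obtain l :: nat and d q where d: "\<And>i. i < l \<Longrightarrow> 0 \<le> d i" and q: "\<And>i. i < l \<Longrightarrow> q i \<in> W"
    and s': "(\<Sum>i<l. d i) = 1" and g: "g = (\<lambda>j. \<Sum>i<l. d i * q i j)"
    using conv_hullE[OF fg(2)] by blast
  let ?I = "{..<k} \<times> {..<l}"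
  have "(\<lambda>j. \<Sum>z\<in>?I. (c (fst z) * d (snd z)) * (p (fst z) j + q (snd z) j)) \<in> conv_hull (conv_hull U)"
  proof (rule conv_hull_finiteI)
    have "(\<Sum>z\<in>?I. c (fst z) * d (snd z)) = (\<Sum>i<k. \<Sum>t<l. c i * d t)"
      by (subst sum.Sigma) (auto simp: split_def)
    then show "(\<Sum>z\<in>?I. c (fst z) * d (snd z)) = 1" using s s' by (simp add: sum_distrib_left[symmetric])
  qed (use c d p q assms in auto)
  moreover have "(\<Sum>z\<in>?I. (c (fst z) * d (snd z)) * (p (fst z) j + q (snd z) j)) = y j" for j
  proof -
    have "(\<Sum>z\<in>?I. (c (fst z) * d (snd z)) * (p (fst z) j + q (snd z) j)) =
        (\<Sum>i<k. \<Sum>t<l. (c i * d t) * (p i j + q t j))"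
      by (subst sum.Sigma) (auto simp: split_def)
    also have "\<dots> = (\<Sum>i<k. \<Sum>t<l. (c i * p i j) * d t) + (\<Sum>i<k. \<Sum>t<l. c i * (d t * q t j))"
      by (simp add: sum.distrib[symmetric] algebra_simps)
    also have "\<dots> = f j + g j"
      using s s' by (simp add: f g sum_distrib_left[symmetric] sum_distrib_right[symmetric])
    finally show ?thesis by (simp add: fg)
  qed
  ultimately show "y \<in> conv_hull U" by (simp add: conv_hull_conv_hull)
qed

lemma conv_hull_subset_minkowski_sum:
  assumes "\<And>y. y \<in> U \<Longrightarrow> \<exists>p\<in>V. \<exists>q\<in>W. y = (\<lambda>j. p j + q j)"
  shows "conv_hull U \<subseteq> minkowski_sum (conv_hull V) (conv_hull W)"
proof
  fix y assume "y \<in> conv_hull U"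
  then obtain k :: nat and c r where c: "\<And>i. i < k \<Longrightarrow> 0 \<le> c i" and r: "\<And>i. i < k \<Longrightarrow> r i \<in> U"
    and s: "(\<Sum>i<k. c i) = 1" and y: "y = (\<lambda>j. \<Sum>i<k. c i * r i j)"
    by (rule conv_hullE) blast
  obtain p q where pq: "\<And>i. i < k \<Longrightarrow> p i \<in> V \<and> q i \<in> W \<and> r i = (\<lambda>j. p i j + q i j)"
    using assms[OF r] by metis
  have "(\<lambda>j. \<Sum>i<k. c i * p i j) \<in> conv_hull V" "(\<lambda>j. \<Sum>i<k. c i * q i j) \<in> conv_hull W"
    using c s pq by (auto intro!: conv_hull_finiteI)
  moreover have "y = (\<lambda>j. (\<Sum>i<k. c i * p i j) + (\<Sum>i<k. c i * q i j))"
    unfolding y by (rule ext) (auto simp: pq sum.distrib[symmetric] distrib_left intro!: sum.cong)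
  ultimately show "y \<in> minkowski_sum (conv_hull V) (conv_hull W)"
    unfolding minkowski_sum_def mem_Collect_eq by (intro exI conjI)
qed

text \<open>Up to translation by the all-ones vector these are the roots e_i - e_j of type
  A.\<close>

definition root_vec :: "nat \<Rightarrow> nat \<times> nat \<Rightarrow> nat \<Rightarrow> real" where
  "root_vec n r k = indic_vec {1..n} k + indic_vec {fst r} k - indic_vec {snd r} k"

text \<open>The functional \<open>y i - y j\<close> separates a root vector from all the others.\<close>

lemma root_vec_in_conv_hull:
  assumes R: "\<And>i' j'. (i', j') \<in> R \<Longrightarrow> i' \<noteq> j'"
    and ij: "i \<in> {1..n}" "j \<in> {1..n}" "i \<noteq> j" and mem: "root_vec n (i, j) \<in> conv_hull (root_vec n ` R)"
  shows "(i, j) \<in> R"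
proof (rule ccontr)
  assume nR: "(i, j) \<notin> R"
  obtain k :: nat and c p where c: "\<And>t. t < k \<Longrightarrow> 0 \<le> c t" and p: "\<And>t. t < k \<Longrightarrow> p t \<in> root_vec n ` R"
    and s: "(\<Sum>t<k. c t) = 1" and y: "root_vec n (i, j) = (\<lambda>m. \<Sum>t<k. c t * p t m)"
    using conv_hullE[OF mem] by blast
  have le: "p t i - p t j \<le> 1" if t: "t < k" for t
  proof -
    obtain i' j' where "(i', j') \<in> R" "p t = root_vec n (i', j')" using p[OF t] by auto
    then show ?thesis using R[of i' j'] nR ij by (auto simp: root_vec_def indic_vec_def)
  qed
  have "2 = root_vec n (i, j) i - root_vec n (i, j) j" using ij by (simp add: root_vec_def indic_vec_def)
  also have "\<dots> = (\<Sum>t<k. c t * (p t i - p t j))" by (simp add: y sum_subtractf right_diff_distrib)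
  also have "\<dots> \<le> (\<Sum>t<k. c t * 1)" using c le by (intro sum_mono mult_left_mono) auto
  finally show False using s by simp
qed

text \<open>A generator of one hull lies in the other, hence is one of its generators by
  \<open>root_vec_in_conv_hull\<close>. This reduces an equality of polytopes to one of sets of
  pairs.\<close>

lemma conv_hull_root_vec_inject:
  assumes "\<And>i j. (i, j) \<in> R \<Longrightarrow> i \<in> {1..n} \<and> j \<in> {1..n} \<and> i \<noteq> j"
    and "\<And>i j. (i, j) \<in> R' \<Longrightarrow> i \<in> {1..n} \<and> j \<in> {1..n} \<and> i \<noteq> j"
    and eq: "conv_hull (root_vec n ` R) = conv_hull (root_vec n ` R')"
  shows "R = R'"
proof -
  have "(i, j) \<in> R'" if "(i, j) \<in> R" for i j
    using that assms conv_hull_superset[of "root_vec n ` R"] by (intro root_vec_in_conv_hull[of R' i n j]) blast+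
  moreover have "(i, j) \<in> R" if "(i, j) \<in> R'" for i j
    using that assms conv_hull_superset[of "root_vec n ` R'"] by (intro root_vec_in_conv_hull[of R i n j]) blast+
  ultimately show ?thesis by auto
qed

lemma pi_vec_eq_root_vec:
  assumes x: "x permutes {1..n}" and "x i = n" "x j = 1" "2 \<le> n"
  shows "pi_vec n x = root_vec n (i, j)"
proof
  fix k
  have "x k = n \<longleftrightarrow> k = i" "x k = 1 \<longleftrightarrow> k = j" "i \<noteq> j"
    using permutes_inj[OF x] assms by (metis injD, metis injD, auto)
  moreover have "i \<in> {1..n}" "j \<in> {1..n}" using permutes_in_image[OF x, of i] permutes_in_image[OF x, of j] assms by auto
  ultimately show "pi_vec n x k = root_vec n (i, j) k"
    using assms by (auto simp: pi_vec_def root_vec_def indic_vec_def)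
qed

lemma bruhat_polytope_eq:
  assumes "2 \<le> n"
  shows "bruhat_polytope n u v =
    conv_hull (root_vec n ` {(i, j). \<exists>x. bruhat_le n u x \<and> bruhat_le n x v \<and> x i = n \<and> x j = 1})"
proof -
  have "{pi_vec n x | x. bruhat_le n u x \<and> bruhat_le n x v} =
    root_vec n ` {(i, j). \<exists>x. bruhat_le n u x \<and> bruhat_le n x v \<and> x i = n \<and> x j = 1}" (is "?l = ?r")
  proof
    show "?l \<subseteq> ?r"
    proof
      fix y assume "y \<in> ?l"
      then obtain x where x: "bruhat_le n u x" "bruhat_le n x v" "y = pi_vec n x" by blast
      then have xp: "x permutes {1..n}" by (simp add: bruhat_le_iff_rank_le)
      obtain i j where "x i = n" "x j = 1" using permutes_position[OF xp, of n] permutes_position[OF xp, of 1] assms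
        by (metis atLeastAtMost_iff le_refl one_le_numeral order_trans)
      then show "y \<in> ?r" using x pi_vec_eq_root_vec[OF xp _ _ assms] by blast
    qed
    show "?r \<subseteq> ?l"
    proof
      fix y assume "y \<in> ?r"
      then obtain i j x where x: "bruhat_le n u x" "bruhat_le n x v" "x i = n" "x j = 1" "y = root_vec n (i, j)" by auto
      then have xp: "x permutes {1..n}" by (simp add: bruhat_le_iff_rank_le)
      have "y = pi_vec n x" using pi_vec_eq_root_vec[OF xp x(3,4) assms] x(5) by simp
      then show "y \<in> ?l" using x by blast
    qed
  qed
  then show ?thesis by (simp add: bruhat_polytope_def)
qed

section \<open>Flag matroids of rank (1, n-1)\<close>

definition point_set :: "nat \<Rightarrow> nat set set \<Rightarrow> nat set" where
  "point_set n M = {i \<in> {1..n}. {i} \<in> M}"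

definition copoint_set :: "nat \<Rightarrow> nat set set \<Rightarrow> nat set" where
  "copoint_set n N = {j \<in> {1..n}. {1..n} - {j} \<in> N}"

lemma rank_one_basis:
  assumes "has_rank n M 1" "B \<in> M"
  shows "\<exists>i \<in> point_set n M. B = {i}"
proof -
  have "card B = 1" "B \<subseteq> {1..n}" using assms by (auto simp: has_rank_def is_matroid_def)
  then show ?thesis using assms(2) by (auto simp: point_set_def card_1_singleton_iff)
qed

lemma corank_one_basis:
  assumes "has_rank n N (n - 1)" "B \<in> N" "1 \<le> n"
  shows "\<exists>j \<in> copoint_set n N. B = {1..n} - {j}"
proof -
  have B: "card B = n - 1" "B \<subseteq> {1..n}" using assms by (auto simp: has_rank_def is_matroid_def)
  have "card ({1..n} - B) = 1" using B assms(3) by (subst card_Diff_subset) (auto intro: finite_subset)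
  then obtain j where j: "{1..n} - B = {j}" using card_1_singletonE by blast
  then have "B = {1..n} - {j}" "j \<in> {1..n}" using B(2) by auto
  then show ?thesis using assms(2) by (auto simp: copoint_set_def)
qed

lemma finite_bases: "has_rank n M r \<Longrightarrow> finite M"
  by (rule finite_subset[of _ "Pow {1..n}"]) (auto simp: has_rank_def is_matroid_def)

lemma bases_nonempty: "has_rank n M r \<Longrightarrow> M \<noteq> {}"
  by (auto simp: has_rank_def is_matroid_def)

lemma alpha_star_iff:
  "i \<in> {1..n} \<Longrightarrow> alpha n M N i = SStar \<longleftrightarrow> i \<in> point_set n M \<and> i \<in> copoint_set n N"
  by (auto simp: alpha_def point_set_def copoint_set_def)

lemma matroid_rank_of_le:
  assumes "finite \<B>" "\<B> \<noteq> {}" "\<And>B. B \<in> \<B> \<Longrightarrow> card (F \<inter> B) \<le> r"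
  shows "matroid_rank_of \<B> F \<le> r"
  unfolding matroid_rank_of_def using assms by (intro Max.boundedI) auto

lemma card_le_matroid_rank_of:
  assumes "finite \<B>" "B \<in> \<B>"
  shows "card (F \<inter> B) \<le> matroid_rank_of \<B> F"
  unfolding matroid_rank_of_def using assms by (intro Max_ge) auto

text \<open>The complement of \<open>point_set\<close> consists of the loops of \<open>M\<close> and
  has rank 0. The flag condition is applied to this flat.\<close>

lemma loops_flat:
  assumes "has_rank n M 1"
  shows "is_flat n M ({1..n} - point_set n M)"
  unfolding is_flat_def
proof (intro conjI ballI)
  let ?F = "{1..n} - point_set n M"
  fix e assume "e \<in> {1..n} - ?F"
  then have e: "{e} \<in> M" by (auto simp: point_set_def)
  have "?F \<inter> B = {}" if "B \<in> M" for B using rank_one_basis[OF assms that] by auto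
  then have "matroid_rank_of M ?F \<le> 0"
    using finite_bases[OF assms] bases_nonempty[OF assms] by (intro matroid_rank_of_le) simp_all
  moreover have "insert e ?F \<inter> {e} = {e}" by blast
  then have "1 \<le> matroid_rank_of M (insert e ?F)"
    using card_le_matroid_rank_of[OF finite_bases[OF assms] e, of "insert e ?F"] by simp
  ultimately show "matroid_rank_of M ?F < matroid_rank_of M (insert e ?F)" by simp
qed auto

text \<open>With a single star \<open>t\<close>, the set of loops of \<open>M\<close> lies in the
  basis \<open>{1..n} - {t}\<close> of \<open>N\<close>, so its rank in \<open>N\<close> is its
  cardinality. Every basis of \<open>N\<close> omits \<open>t\<close> or a loop, so adding
  \<open>t\<close> does not raise the rank, and the loops do not form a flat of
  \<open>N\<close>.\<close>

lemma flag_matroid_common_not_singleton: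
  assumes "flag_matroid_1_nm1 n M N"
  shows "point_set n M \<inter> copoint_set n N \<noteq> {t}"
proof
  assume t: "point_set n M \<inter> copoint_set n N = {t}"
  let ?F = "{1..n} - point_set n M"
  have M: "has_rank n M 1" and N: "has_rank n N (n - 1)" using assms by (auto simp: flag_matroid_1_nm1_def)
  have tn: "t \<in> {1..n}" "t \<in> point_set n M" "{1..n} - {t} \<in> N" using t by (auto simp: point_set_def copoint_set_def)
  have "is_flat n N ?F" using assms loops_flat[OF M] by (simp add: flag_matroid_1_nm1_def)
  then have lt: "matroid_rank_of N ?F < matroid_rank_of N (insert t ?F)"
    using tn by (simp add: is_flat_def)
  have "?F \<inter> ({1..n} - {t}) = ?F" using tn by auto
  then have "card ?F \<le> matroid_rank_of N ?F"
    using card_le_matroid_rank_of[OF finite_bases[OF N] tn(3), of ?F] by simp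
  moreover have "matroid_rank_of N (insert t ?F) \<le> card ?F"
  proof (rule matroid_rank_of_le[OF finite_bases[OF N] bases_nonempty[OF N]])
    fix B assume "B \<in> N"
    then obtain j where j: "j \<in> copoint_set n N" "B = {1..n} - {j}"
      using corank_one_basis[OF N] tn(1) by auto
    have card: "card (insert t ?F) = Suc (card ?F)" using tn by simp
    have "j \<in> insert t ?F" using j t by (auto simp: copoint_set_def)
    then have "card (insert t ?F - {j}) = card ?F" using card card_Diff_singleton[of j "insert t ?F"] by simp
    moreover have "insert t ?F \<inter> B = insert t ?F - {j}" using j tn by auto
    ultimately show "card (insert t ?F \<inter> B) \<le> card ?F" by simp
  qed
  ultimately show False using lt by simp
qed

text \<open>Without a star, an element \<open>e\<close> with positive weight in the first summand
  lies in every basis of \<open>N\<close>. The coordinate \<open>e\<close> of the sum then exceeds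
  1, although the point translated to the origin is the all-ones vector.\<close>

lemma point_copoint_common:
  assumes M: "has_rank n M 1" and N: "has_rank n N (n - 1)" and n: "1 \<le> n"
    and origin: "(\<lambda>j::nat. 0::real) \<in> (\<lambda>p. (\<lambda>j. p j - indic_vec {1..n} j)) ` flag_polytope n M N"
  shows "point_set n M \<inter> copoint_set n N \<noteq> {}"
proof
  assume disj: "point_set n M \<inter> copoint_set n N = {}"
  obtain y where y: "y \<in> flag_polytope n M N" and y0: "(\<lambda>j::nat. 0::real) = (\<lambda>j. y j - indic_vec {1..n} j)"
    using origin by blast
  have y1: "y k = indic_vec {1..n} k" for k using fun_cong[OF y0, of k] by simp
  from y obtain f g where f: "f \<in> conv_hull {indic_vec {i} | i. i \<in> {1..n} \<and> {i} \<in> M}"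
    and g: "g \<in> conv_hull {indic_vec B | B. B \<in> N}" and fg: "y = (\<lambda>j. f j + g j)"
    by (auto simp: flag_polytope_def minkowski_sum_def)
  obtain k :: nat and c p where c: "\<And>i. i < k \<Longrightarrow> 0 \<le> c i"
    and p: "\<And>i. i < k \<Longrightarrow> p i \<in> {indic_vec {i} | i. i \<in> {1..n} \<and> {i} \<in> M}"
    and s: "(\<Sum>i<k. c i) = 1" and fe: "f = (\<lambda>j. \<Sum>i<k. c i * p i j)"
    using conv_hullE[OF f] by blast
  obtain l :: nat and d q where q: "\<And>i. i < l \<Longrightarrow> q i \<in> {indic_vec B | B. B \<in> N}"
    and s': "(\<Sum>i<l. d i) = 1" and ge: "g = (\<lambda>j. \<Sum>i<l. d i * q i j)"
    using conv_hullE[OF g] by blast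
  obtain m where m: "m < k" "c m \<noteq> 0" using s by (metis lessThan_iff sum.neutral zero_neq_one)
  obtain e where e: "e \<in> {1..n}" "{e} \<in> M" "p m = indic_vec {e}" using p[OF m(1)] by blast
  have eS: "e \<in> point_set n M" using e by (simp add: point_set_def)
  have "q t e = 1" if t: "t < l" for t
  proof -
    obtain B where B: "B \<in> N" "q t = indic_vec B" using q[OF t] by blast
    obtain j where "j \<in> copoint_set n N" "B = {1..n} - {j}" using corank_one_basis[OF N B(1) n] by blast
    moreover have "j \<noteq> e" using calculation eS disj by blast
    ultimately show ?thesis using B e by (simp add: indic_vec_def)
  qed
  then have "g e = 1" using s' by (simp add: ge)
  moreover have "c m * p m e \<le> f e"
    unfolding fe
  proof (rule member_le_sum)
    fix i assume i: "i \<in> {..<k} - {m}"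
    obtain e' where "p i = indic_vec {e'}" using p[of i] i by blast
    then show "0 \<le> c i * p i e" using c[of i] i by (simp add: indic_vec_def)
  qed (use m in auto)
  moreover have "p m e = 1" "0 < c m" using e c[OF m(1)] m(2) by (simp_all add: indic_vec_def)
  moreover have "f e + g e = 1" using y1[of e] e(1) fg by (simp add: indic_vec_def)
  ultimately show False by simp
qed

text \<open>A sum with \<open>i = j\<close> is the all-ones vector, which is the midpoint of the
  root vectors of \<open>(k, l)\<close> and \<open>(l, k)\<close>; this is where two stars
  enter.\<close>

lemma flag_polytope_eq:
  assumes N: "has_rank n N (n - 1)" and n: "1 \<le> n"
    and kl: "k \<in> point_set n M \<inter> copoint_set n N" "l \<in> point_set n M \<inter> copoint_set n N" "k \<noteq> l"
  shows "flag_polytope n M N =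
    conv_hull (root_vec n ` {(i, j). i \<in> point_set n M \<and> j \<in> copoint_set n N \<and> i \<noteq> j})"
    (is "_ = conv_hull (root_vec n ` ?R)")
proof
  have split: "(\<lambda>t. indic_vec {i} t + indic_vec ({1..n} - {j}) t) = root_vec n (i, j)" if "j \<in> {1..n}" for i j
    using that by (auto simp: fun_eq_iff root_vec_def indic_vec_def)
  show "flag_polytope n M N \<subseteq> conv_hull (root_vec n ` ?R)"
    unfolding flag_polytope_def
  proof (rule minkowski_sum_conv_hull_subset)
    fix p q assume p: "p \<in> {indic_vec {i} | i. i \<in> {1..n} \<and> {i} \<in> M}" and q: "q \<in> {indic_vec B | B. B \<in> N}"
    obtain i where i: "p = indic_vec {i}" "i \<in> point_set n M" using p by (auto simp: point_set_def)
    obtain B where B: "q = indic_vec B" "B \<in> N" using q by blast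
    obtain j where j: "j \<in> copoint_set n N" "B = {1..n} - {j}" using corank_one_basis[OF N B(2) n] by blast
    have eq: "(\<lambda>t. p t + q t) = root_vec n (i, j)" using split[of j i] i B j by (simp add: copoint_set_def)
    show "(\<lambda>t. p t + q t) \<in> conv_hull (root_vec n ` ?R)"
    proof (cases "i = j")
      case False
      then have "root_vec n (i, j) \<in> root_vec n ` ?R" using i j by blast
      then show ?thesis unfolding eq by (rule subsetD[OF conv_hull_superset])
    next
      case True
      let ?h = "\<lambda>b. if b then root_vec n (k, l) else root_vec n (l, k)"
      have "(\<lambda>t. \<Sum>b\<in>{True, False}. (1/2) * ?h b t) \<in> conv_hull (root_vec n ` ?R)"
        using kl by (intro conv_hull_finiteI) auto
      moreover have "(\<lambda>t. \<Sum>b\<in>{True, False}. (1/2) * ?h b t) = root_vec n (i, j)"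
        using True by (auto simp: fun_eq_iff root_vec_def field_simps)
      ultimately show ?thesis unfolding eq by simp
    qed
  qed
  show "conv_hull (root_vec n ` ?R) \<subseteq> flag_polytope n M N"
    unfolding flag_polytope_def
  proof (rule conv_hull_subset_minkowski_sum)
    fix y assume "y \<in> root_vec n ` ?R"
    then obtain i j where y: "y = root_vec n (i, j)" "i \<in> point_set n M" "j \<in> copoint_set n N" by blast
    have "indic_vec {i} \<in> {indic_vec {i} | i. i \<in> {1..n} \<and> {i} \<in> M}" using y by (auto simp: point_set_def)
    moreover have "indic_vec ({1..n} - {j}) \<in> {indic_vec B | B. B \<in> N}" using y by (auto simp: copoint_set_def)
    moreover have "y = (\<lambda>t. indic_vec {i} t + indic_vec ({1..n} - {j}) t)"
      using split[of j i] y by (simp add: copoint_set_def)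
    ultimately show "\<exists>p\<in>{indic_vec {i} | i. i \<in> {1..n} \<and> {i} \<in> M}. \<exists>q\<in>{indic_vec B | B. B \<in> N}. y = (\<lambda>j. p j + q j)"
      by blast
  qed
qed

text \<open>A nonzero count of values at least \<open>n\<close>, or of values below 2, is inherited
  by \<open>v\<close>. The permutation \<open>v\<close> is arbitrary because the bounds serve to
  establish \<open>a < b\<close>, before the locale \<open>top_positions\<close> is
  available.\<close>

lemma rank_le_position_bounds:
  assumes x: "x permutes {1..n}" and v: "v permutes {1..n}" and le: "rank_le n x v" and n: "2 \<le> n"
  shows "x i = n \<Longrightarrow> v a = n \<Longrightarrow> i \<in> {1..n} \<Longrightarrow> a \<le> i"
    and "x j = 1 \<Longrightarrow> v b = 1 \<Longrightarrow> j \<in> {1..n} \<Longrightarrow> j \<le> b"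
proof -
  note inj = injD[OF permutes_inj[OF v]]
  have rng: "1 \<le> v k \<and> v k \<le> n" if "1 \<le> k" "k \<le> n" for k using permutes_in_image[OF v, of k] that by simp
  show "a \<le> i" if i: "x i = n" "v a = n" "i \<in> {1..n}"
  proof -
    have "rk x i n \<noteq> 0" using i unfolding rk_eq_0_iff by force
    then have "rk v i n \<noteq> 0" using le i by (metis atLeastAtMost_iff le_zero_eq rank_le_def)
    then obtain k where k: "1 \<le> k" "k \<le> i" "n \<le> v k" unfolding rk_eq_0_iff by (auto simp: not_less)
    have "v k = n" using rng[of k] k i by simp
    then show ?thesis using inj[of k a] i k by simp
  qed
  show "j \<le> b" if j: "x j = 1" "v b = 1" "j \<in> {1..n}"
  proof -
    have "lk n x (j - 1) 2 \<noteq> 0" using j unfolding lk_eq_0_iff by force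
    then have "lk n v (j - 1) 2 \<noteq> 0" using rank_leD_lk[OF le x v, of "j - 1" 2] j n by fastforce
    then obtain k where k: "j - 1 < k" "k \<le> n" "v k < 2" unfolding lk_eq_0_iff by (auto simp: not_le)
    have "v k = 1" using rng[of k] k by simp
    then show ?thesis using inj[of k b] j k by simp
  qed
qed

section \<open>Comparison of the two sets of pairs\<close>

theorem theorem6p4:
  fixes n :: nat and M N :: "nat set set"
  assumes "flag_matroid_1_nm1 n M N"
    and "(\<lambda>j::nat. 0::real) \<in> (\<lambda>p. (\<lambda>j. p j - indic_vec {1..n} j)) ` flag_polytope n M N"
  shows "is_bruhat_polytope n (flag_polytope n M N) \<longleftrightarrow> \<not> has_isolated_star n (alpha n M N)"
proof -
  define S where "S = point_set n M"
  define T where "T = copoint_set n N"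
  have M: "has_rank n M 1" and N: "has_rank n N (n - 1)"
    using assms(1) by (auto simp: flag_matroid_1_nm1_def)
  have SV: "S \<subseteq> {1..n}" and TV: "T \<subseteq> {1..n}" by (auto simp: S_def T_def point_set_def copoint_set_def)
  have n1: "1 \<le> n" using bases_nonempty[OF M] rank_one_basis[OF M] SV unfolding S_def by fastforce
  obtain k l where kl: "k \<in> S \<inter> T" "l \<in> S \<inter> T" "k < l"
  proof -
    obtain k where k: "k \<in> S \<inter> T" using point_copoint_common[OF M N n1 assms(2)] by (auto simp: S_def T_def)
    then obtain l where "l \<in> S \<inter> T" "k \<noteq> l"
      using flag_matroid_common_not_singleton[OF assms(1), of k] unfolding S_def T_def by blast
    then show ?thesis using that k by (cases k l rule: linorder_cases) auto
  qed
  have "k \<in> {1..n}" "l \<in> {1..n}" using kl SV by blast+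
  then have n2: "2 \<le> n" using kl(3) by simp
  define R where "R = {(i, j). i \<in> S \<and> j \<in> T \<and> i \<noteq> j}"
  have P: "flag_polytope n M N = conv_hull (root_vec n ` R)"
    unfolding R_def S_def T_def by (rule flag_polytope_eq[OF N n1, of k M l]) (use kl in \<open>auto simp: S_def T_def\<close>)
  have star: "i \<in> {1..n} \<Longrightarrow> alpha n M N i = SStar \<longleftrightarrow> i \<in> S \<and> i \<in> T" for i
    by (simp add: alpha_star_iff S_def T_def)
  show ?thesis
  proof
    assume "is_bruhat_polytope n (flag_polytope n M N)"
    then obtain u v where uv: "bruhat_le n u v" "minimal_perm n v" "flag_polytope n M N = bruhat_polytope n u v"
      by (auto simp: is_bruhat_polytope_def)
    then have u: "u permutes {1..n}" and v: "v permutes {1..n}" and uv_le: "rank_le n u v"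
      by (auto simp: bruhat_le_iff_rank_le)
    let ?Z = "{(i, j). \<exists>x. bruhat_le n u x \<and> bruhat_le n x v \<and> x i = n \<and> x j = 1}"
    have "R = ?Z"
    proof (rule conv_hull_root_vec_inject[of R n])
      show "conv_hull (root_vec n ` R) = conv_hull (root_vec n ` ?Z)"
        using P uv(3) bruhat_polytope_eq[OF n2, of u v] by simp
      show "i \<in> {1..n} \<and> j \<in> {1..n} \<and> i \<noteq> j" if "(i, j) \<in> R" for i j
        using that SV TV by (auto simp: R_def)
      show "i \<in> {1..n} \<and> j \<in> {1..n} \<and> i \<noteq> j" if ij: "(i, j) \<in> ?Z" for i j
      proof -
        obtain x where x: "x permutes {1..n}" "x i = n" "x j = 1"
          using ij unfolding bruhat_le_iff_rank_le by blast
        then show ?thesis using permutes_in_image[OF x(1), of i] permutes_in_image[OF x(1), of j] n2 by auto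
      qed
    qed
    then have Z: "i \<in> S \<and> j \<in> T \<and> i \<noteq> j \<longleftrightarrow> (\<exists>x. x permutes {1..n} \<and> rank_le n u x \<and> rank_le n x v \<and> x i = n \<and> x j = 1)" for i j
      using u v unfolding R_def bruhat_le_iff_rank_le set_eq_iff by auto
    obtain a where a: "a \<in> {1..n}" "v a = n" using permutes_position[OF v, of n] n2 by auto
    obtain b where b: "b \<in> {1..n}" "v b = 1" using permutes_position[OF v, of 1] n2 by auto
    \<comment> \<open>The pair \<open>(k, l)\<close> of two stars belongs to \<open>R\<close>, so it
      is realised below \<open>v\<close>. With \<open>k < l\<close> the position bounds then give
      \<open>a < b\<close>.\<close>
    obtain x where x: "x permutes {1..n}" "rank_le n x v" "x k = n" "x l = 1"
      using Z[of k l] kl by auto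
    have "a \<le> k" "l \<le> b" using rank_le_position_bounds[OF x(1) v x(2) n2] x(3,4) a b kl SV by auto
    then interpret t: top_positions n a b using a b kl by unfold_locales auto
    have vt: "v = top_perm n a b" using t.minimal_perm_iff[OF v a(2) b(2)] uv(2) by simp
    have Z': "i \<in> S \<and> j \<in> T \<and> i \<noteq> j \<longleftrightarrow> i \<noteq> j \<and> pos_top n a b u i \<and> pos_one n a b u j" for i j
      using Z[of i j] t.positions_iff[OF u, of i j] uv_le unfolding vt by blast
    have "pos_top n a b u k" "pos_one n a b u k" "pos_top n a b u l" "pos_one n a b u l"
      using Z'[of k l] Z'[of l k] kl by auto
    \<comment> \<open>Only pairs with distinct entries are compared, but every \<open>i\<close>
      differs from \<open>k\<close> or from \<open>l\<close>, and both of these belong to all the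
      sets involved.\<close>
    then have ST: "i \<in> S \<longleftrightarrow> pos_top n a b u i" "i \<in> T \<longleftrightarrow> pos_one n a b u i" for i
      using Z'[of i k] Z'[of i l] Z'[of k i] Z'[of l i] kl by auto
    show "\<not> has_isolated_star n (alpha n M N)"
    proof
      assume "has_isolated_star n (alpha n M N)"
      then obtain i where i: "i \<in> {1..n}" "alpha n M N i = SStar"
        "\<not> (i - 1 \<ge> 1 \<and> alpha n M N (i - 1) = SStar)" "\<not> (i + 1 \<le> n \<and> alpha n M N (i + 1) = SStar)"
        by (auto simp: has_isolated_star_def)
      have "i \<in> S" "i \<in> T" using star i by auto
      then have "(1 \<le> i - 1 \<and> i - 1 \<in> S \<and> i - 1 \<in> T) \<or> (Suc i \<le> n \<and> Suc i \<in> S \<and> Suc i \<in> T)"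
        using t.not_isolated[OF u, of i] by (simp add: ST)
      moreover have "i - 1 \<le> n" using i(1) by auto
      ultimately show False using i(3,4) star[of "i - 1"] star[of "Suc i"] by auto
    qed
  next
    assume noiso: "\<not> has_isolated_star n (alpha n M N)"
    \<comment> \<open>The choice is forced: the positions satisfying \<open>pos_top\<close> start at
      \<open>a\<close>, and those satisfying \<open>pos_one\<close> end at \<open>b\<close>.\<close>
    define a where "a = Min S"
    define b where "b = Max T"
    have fin: "finite S" "finite T" using SV TV finite_subset by blast+
    have aS: "a \<in> S" "\<And>i. i \<in> S \<Longrightarrow> a \<le> i" using fin kl by (auto simp: a_def intro: Min_in)
    have bT: "b \<in> T" "\<And>j. j \<in> T \<Longrightarrow> j \<le> b" using fin kl by (auto simp: b_def intro: Max_in)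
    have "a < b" using aS(2)[of k] bT(2)[of l] kl by auto
    then interpret t: top_positions n a b using aS(1) bT(1) SV TV by unfold_locales auto
    have iso: "(m - 1 \<in> S \<and> m - 1 \<in> T) \<or> (Suc m \<in> S \<and> Suc m \<in> T)" if m: "m \<in> S" "m \<in> T" for m
    proof -
      have mn: "m \<in> {1..n}" using m SV by blast
      then have "alpha n M N m = SStar" using star m by simp
      then have "(m - 1 \<ge> 1 \<and> alpha n M N (m - 1) = SStar) \<or> (m + 1 \<le> n \<and> alpha n M N (m + 1) = SStar)"
        using noiso mn unfolding has_isolated_star_def by blast
      moreover have "m - 1 \<le> n" using mn by auto
      ultimately show ?thesis using star[of "m - 1"] star[of "Suc m"] by auto
    qed
    obtain u where u: "u permutes {1..n}" "rank_le n u (top_perm n a b)"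
      and ST: "\<And>i. pos_top n a b u i \<longleftrightarrow> i \<in> S" "\<And>j. pos_one n a b u j \<longleftrightarrow> j \<in> T"
      using t.exists_bottom[OF SV aS TV bT iso] by blast
    have "R = {(i, j). \<exists>x. bruhat_le n u x \<and> bruhat_le n x (top_perm n a b) \<and> x i = n \<and> x j = 1}"
      using t.positions_iff[OF u] u(1) t.top_permutes unfolding R_def bruhat_le_iff_rank_le ST by blast
    then have "flag_polytope n M N = bruhat_polytope n u (top_perm n a b)"
      using P bruhat_polytope_eq[OF n2, of u "top_perm n a b"] by simp
    moreover have "minimal_perm n (top_perm n a b)"
      using t.minimal_perm_iff[OF t.top_permutes t.top_perm_a t.top_perm_b] by simp
    moreover have "bruhat_le n u (top_perm n a b)" using u t.top_permutes by (simp add: bruhat_le_iff_rank_le)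
    ultimately show "is_bruhat_polytope n (flag_polytope n M N)" unfolding is_bruhat_polytope_def by blast
  qed
qed

end
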